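(* Let $k\ge1$ and $0\le t\le k$. Let $\mathcal{L}_t$ be the $2k$-dimensional Leibniz algebra over $\mathbb{C}$ with basis $\{e_1,\dots,e_t,x_1,\dots,x_t,y_1,\dots,y_{k-t},f_1,\dots,f_{k-t}\}$ and products $$[e_i,x_i]=e_i\ (1\le i\le t),\qquad [f_j,y_j]=f_j,\quad [y_j,f_j]=-f_j\ (1\le j\le k-t),$$ all other products of basis elements being zero. Then $\mathcal{L}_t$ is rigid, i.e. its orbit $\operatorname{Orb}(\mathcal{L}_t)$ under the action of $\mathrm{GL}_{2k}(\mathbb{C})$ is Zariski open in the variety of $2k$-dimensional Leibniz algebra structures.
   Context: A (right) Leibniz algebra is a vector space $L$ with a bilinear bracket satisfying $[x,[y,z]]=[[x,y],z]-[[x,z],y]$ for all $x,y,z\in L$. The variety $\mathrm{Leib}_m$ of $m$-dimensional Leibniz algebra structures is the set of bilinear maps $\lambda:\mathbb{C}^m\times\mathbb{C}^m\to\mathbb{C}^m$ satisfying the Leibniz identity (a Zariski closed subset of the affine space of bilinear maps). $\mathrm{GL}_m(\mathbb{C})$ acts on it by $(g*\lambda)(x,y)=g(\lambda(g^{-1}(x),g^{-1}(y)))$; orbits are the isomorphism classes. A Leibniz algebra is called rigid if its orbit is Zariski open in $\mathrm{Leib}_m$. *)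

theory Defs
  imports "HOL-Analysis.Analysis"
begin

text \<open>
  The space \<open>\<complex>\<^sup>m\<close> is \<^typ>\<open>complex^'n\<close> with \<open>m = CARD('n)\<close>.  The predicate \<open>bilinear\<close> of
  HOL-Analysis means real-bilinear, hence the complex version here.
\<close>

definition cbilinear_maps :: "(complex^'n \<Rightarrow> complex^'n \<Rightarrow> complex^'n) set" where
  "cbilinear_maps =
     {lam. (\<forall>x. Vector_Spaces.linear (*s) (*s) (\<lambda>y. lam x y)) \<and>
           (\<forall>y. Vector_Spaces.linear (*s) (*s) (\<lambda>x. lam x y))}"

definition Leib :: "(complex^'n \<Rightarrow> complex^'n \<Rightarrow> complex^'n) set" where
  "Leib = {lam \<in> cbilinear_maps.
     \<forall>x y z. lam x (lam y z) = lam (lam x y) z - lam (lam x z) y}"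

definition GL :: "(complex^'n^'n) set" where
  "GL = {g. invertible g}"

definition GL_action ::
  "complex^'n^'n \<Rightarrow> (complex^'n \<Rightarrow> complex^'n \<Rightarrow> complex^'n)
     \<Rightarrow> (complex^'n \<Rightarrow> complex^'n \<Rightarrow> complex^'n)" where
  "GL_action g lam = (\<lambda>x y. g *v lam (matrix_inv g *v x) (matrix_inv g *v y))"

definition Orb ::
  "(complex^'n \<Rightarrow> complex^'n \<Rightarrow> complex^'n) \<Rightarrow> (complex^'n \<Rightarrow> complex^'n \<Rightarrow> complex^'n) set" where
  "Orb lam = (\<lambda>g. GL_action g lam) ` GL"

text \<open>
  Polynomial functions on the affine space of bilinear maps, whose affine coordinates are the
  structure constants with respect to the standard basis.
\<close>

inductive_set poly_funs :: "((complex^'n \<Rightarrow> complex^'n \<Rightarrow> complex^'n) \<Rightarrow> complex) set" where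
  const: "(\<lambda>lam. c) \<in> poly_funs"
| coord: "(\<lambda>lam. lam (axis i 1) (axis j 1) $ l) \<in> poly_funs"
| add: "p \<in> poly_funs \<Longrightarrow> q \<in> poly_funs \<Longrightarrow> (\<lambda>lam. p lam + q lam) \<in> poly_funs"
| mult: "p \<in> poly_funs \<Longrightarrow> q \<in> poly_funs \<Longrightarrow> (\<lambda>lam. p lam * q lam) \<in> poly_funs"

definition zero_locus ::
  "((complex^'n \<Rightarrow> complex^'n \<Rightarrow> complex^'n) \<Rightarrow> complex) set
     \<Rightarrow> (complex^'n \<Rightarrow> complex^'n \<Rightarrow> complex^'n) set" where
  "zero_locus P = {lam \<in> cbilinear_maps. \<forall>p\<in>P. p lam = 0}"

definition zariski_closed :: "(complex^'n \<Rightarrow> complex^'n \<Rightarrow> complex^'n) set \<Rightarrow> bool" where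
  "zariski_closed Z \<longleftrightarrow> (\<exists>P\<subseteq>poly_funs. Z = zero_locus P)"

definition zariski_topology :: "(complex^'n \<Rightarrow> complex^'n \<Rightarrow> complex^'n) topology" where
  "zariski_topology =
     topology (\<lambda>U. U \<subseteq> cbilinear_maps \<and> zariski_closed (cbilinear_maps - U))"

lemma zariski_closed_Un:
  assumes "zariski_closed Y" "zariski_closed Z"
  shows "zariski_closed (Y \<union> Z)"
proof -
  obtain P Q where P: "P \<subseteq> poly_funs" "Y = zero_locus P" and Q: "Q \<subseteq> poly_funs" "Z = zero_locus Q"
    using assms unfolding zariski_closed_def by blast
  let ?R = "(\<lambda>(p,q) lam. p lam * q lam) ` (P \<times> Q)"
  have "?R \<subseteq> poly_funs"
    using P(1) Q(1) by (auto intro!: poly_funs.mult)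
  moreover have "Y \<union> Z = zero_locus ?R"
    unfolding P(2) Q(2) zero_locus_def by auto
  ultimately show ?thesis
    unfolding zariski_closed_def by blast
qed

lemma zariski_closed_Inter:
  assumes "\<And>Z. Z \<in> \<Z> \<Longrightarrow> zariski_closed Z"
  shows "zariski_closed (cbilinear_maps \<inter> \<Inter>\<Z>)"
proof -
  obtain P where P: "\<And>Z. Z \<in> \<Z> \<Longrightarrow> P Z \<subseteq> poly_funs \<and> Z = zero_locus (P Z)"
    using assms unfolding zariski_closed_def by metis
  have "(\<Union>(P ` \<Z>)) \<subseteq> poly_funs"
    using P by blast
  moreover have "cbilinear_maps \<inter> \<Inter>\<Z> = zero_locus (\<Union>(P ` \<Z>))"
  proof (intro equalityI subsetI)
    fix lam assume "lam \<in> cbilinear_maps \<inter> \<Inter>\<Z>"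
    then show "lam \<in> zero_locus (\<Union>(P ` \<Z>))"
      using P unfolding zero_locus_def by blast
  next
    fix lam assume lam: "lam \<in> zero_locus (\<Union>(P ` \<Z>))"
    have "lam \<in> Z" if "Z \<in> \<Z>" for Z
    proof -
      have "lam \<in> zero_locus (P Z)"
        using lam that unfolding zero_locus_def by blast
      then show ?thesis using P[OF that] by simp
    qed
    then show "lam \<in> cbilinear_maps \<inter> \<Inter>\<Z>"
      using lam unfolding zero_locus_def by blast
  qed
  ultimately show ?thesis
    unfolding zariski_closed_def by blast
qed

lemma openin_zariski_topology:
  fixes U :: "(complex^'n \<Rightarrow> complex^'n \<Rightarrow> complex^'n) set"
  shows "openin zariski_topology U \<longleftrightarrow> U \<subseteq> cbilinear_maps \<and> zariski_closed (cbilinear_maps - U)"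
proof -
  have "istopology (\<lambda>U :: (complex^'n \<Rightarrow> complex^'n \<Rightarrow> complex^'n) set.
      U \<subseteq> cbilinear_maps \<and> zariski_closed (cbilinear_maps - U))"
    unfolding istopology_def
  proof (intro conjI allI impI)
    fix S T :: "(complex^'n \<Rightarrow> complex^'n \<Rightarrow> complex^'n) set"
    assume "S \<subseteq> cbilinear_maps \<and> zariski_closed (cbilinear_maps - S)"
      and "T \<subseteq> cbilinear_maps \<and> zariski_closed (cbilinear_maps - T)"
    then show "S \<inter> T \<subseteq> cbilinear_maps" "zariski_closed (cbilinear_maps - (S \<inter> T))"
      by (auto simp: Diff_Int zariski_closed_Un)
  next
    fix \<K> :: "(complex^'n \<Rightarrow> complex^'n \<Rightarrow> complex^'n) set set"
    assume K: "\<forall>K\<in>\<K>. K \<subseteq> cbilinear_maps \<and> zariski_closed (cbilinear_maps - K)"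
    then show "\<Union>\<K> \<subseteq> cbilinear_maps" by blast
    have "cbilinear_maps - \<Union>\<K> = cbilinear_maps \<inter> \<Inter>((\<lambda>K. cbilinear_maps - K) ` \<K>)"
      by blast
    moreover have "zariski_closed (cbilinear_maps \<inter> \<Inter>((\<lambda>K. cbilinear_maps - K) ` \<K>))"
      using K by (intro zariski_closed_Inter) auto
    ultimately show "zariski_closed (cbilinear_maps - \<Union>\<K>)" by simp
  qed
  then show ?thesis
    unfolding zariski_topology_def by (simp add: topology_inverse')
qed

lemma topspace_zariski_topology: "topspace zariski_topology = cbilinear_maps"
proof (rule equalityI)
  show "topspace zariski_topology \<subseteq> cbilinear_maps"
    unfolding topspace_def by (auto simp: openin_zariski_topology)
  have "zariski_closed {}"
    unfolding zariski_closed_def zero_locus_def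
    by (rule exI[of _ "{\<lambda>lam. 1}"]) (auto intro: poly_funs.const)
  then show "cbilinear_maps \<subseteq> topspace zariski_topology"
    by (intro openin_subset) (simp add: openin_zariski_topology)
qed

definition rigid :: "(complex^'n \<Rightarrow> complex^'n \<Rightarrow> complex^'n) \<Rightarrow> bool" where
  "rigid lam \<longleftrightarrow> lam \<in> Leib \<and> openin (subtopology zariski_topology Leib) (Orb lam)"

datatype label = E nat | X nat | Y nat | F nat

definition labels :: "nat \<Rightarrow> nat \<Rightarrow> label set" where
  "labels k t = E ` {1..t} \<union> X ` {1..t} \<union> Y ` {1..k - t} \<union> F ` {1..k - t}"

text \<open>
  A bijection \<open>b\<close> from \<open>labels k t\<close> to the index type names the standard basis vectors
  \<open>e\<^sub>i, x\<^sub>i, y\<^sub>j, f\<^sub>j\<close>.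
\<close>

definition basis_vec :: "(label \<Rightarrow> 'n) \<Rightarrow> label \<Rightarrow> complex^'n" where
  "basis_vec b p = axis (b p) 1"

fun basis_product :: "(label \<Rightarrow> 'n) \<Rightarrow> label \<Rightarrow> label \<Rightarrow> complex^'n" where
  "basis_product b (E i) (X j) = (if i = j then basis_vec b (E i) else 0)"
| "basis_product b (F i) (Y j) = (if i = j then basis_vec b (F i) else 0)"
| "basis_product b (Y i) (F j) = (if i = j then - basis_vec b (F i) else 0)"
| "basis_product b _ _ = 0"

definition L_alg :: "nat \<Rightarrow> nat \<Rightarrow> (label \<Rightarrow> 'n) \<Rightarrow> complex^'n \<Rightarrow> complex^'n \<Rightarrow> complex^'n" where
  "L_alg k t b u v =
     (\<Sum>p\<in>labels k t. \<Sum>q\<in>labels k t. (u $ b p * v $ b q) *s basis_product b p q)"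

lemma finite_labels: "finite (labels k t)"
  unfolding labels_def by simp

lemma card_labels:
  assumes "t \<le> k"
  shows "card (labels k t) = 2 * k"
proof -
  have "card (labels k t) = card (E ` {1..t}) + card (X ` {1..t})
      + card (Y ` {1..k - t}) + card (F ` {1..k - t})"
    unfolding labels_def by (subst card_Un_disjoint, simp, simp, blast)+ simp
  also have "\<dots> = t + t + (k - t) + (k - t)"
    by (simp add: card_image inj_on_def)
  finally show ?thesis using assms by simp
qed

lemma L_alg_basis:
  assumes b: "bij_betw b (labels k t) (UNIV :: 'n::finite set)"
    and pq: "p \<in> labels k t" "q \<in> labels k t"
  shows "L_alg k t b (basis_vec b p) (basis_vec b q) = basis_product b p q"
proof -
  have inj: "b r = b s \<longleftrightarrow> r = s" if "r \<in> labels k t" "s \<in> labels k t" for r s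
    using b that unfolding bij_betw_def inj_on_def by blast
  have "L_alg k t b (basis_vec b p) (basis_vec b q) =
     (\<Sum>r\<in>labels k t. \<Sum>s\<in>labels k t. if s = q then (if r = p then basis_product b r s else 0) else 0)"
    unfolding L_alg_def basis_vec_def axis_def
    by (intro sum.cong refl) (auto simp: inj pq)
  also have "\<dots> = basis_product b p q"
    using pq by (simp add: finite_labels)
  finally show ?thesis .
qed

end

theory Submission
  imports Defs "Jordan_Normal_Form.Determinant" "HOL-Computational_Algebra.Fundamental_Theorem_Algebra"
begin

text \<open>
  Openness of the orbit follows from one polynomial on bilinear maps that does not vanish at
  \<open>L = L_t\<close> and whose non-vanishing at a Leibniz structure \<open>lam\<close> forces \<open>lam\<close> to be
  isomorphic to \<open>L\<close>: the orbit is then the union of the \<open>GL\<close>-translates of this basic open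
  set, cut down to \<open>Leib\<close> (lemma \<open>rigid_if_basic_open\<close>).

  To find the polynomial, rename the basis as \<open>e_l, h_l\<close> with \<open>l < k\<close>, so that
  \<open>[e_l, h_l] = e_l\<close> for all \<open>l\<close> and \<open>[h_l, e_l] = - e_l\<close> for \<open>l \<ge> t\<close>.  Fix the vectors
  \<open>a = \<Sum> (l + 1) h_l\<close> and \<open>u = \<Sum> e_l\<close>.  For an arbitrary Leibniz product write
  \<open>R x = [x, a]\<close>, which is a derivation, and \<open>\<tau>_j b = tr (x \<mapsto> [R^(j+1) x, b])\<close>.
  Three \<open>k \<times> k\<close> determinants, polynomial in the structure constants, are required to be nonzero.

  (1) The minor in the coordinates \<open>e_l\<close> of \<open>R^2 u, \<dots>, R^(k+1) u\<close>, so that \<open>R\<close> has rank at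
  least \<open>k\<close>.

  (2) The matrix \<open>\<tau>_j h_l\<close>.  Right multiplication by \<open>[x, a]\<close> is a commutator with \<open>R\<close>, so
  every \<open>\<tau>_j\<close> kills the image of \<open>R\<close>; thus the rank of \<open>R\<close> is at most \<open>k\<close>.  This is what keeps
  the rank from jumping near \<open>L\<close>.  The image \<open>V\<close> of \<open>R\<close> and its kernel \<open>N\<close> are therefore
  complementary of dimension \<open>k\<close>, and \<open>R u\<close> is a cyclic vector for \<open>R\<close> on \<open>V\<close>.  A double
  eigenvalue of \<open>R\<close> on \<open>V\<close> would give a nonzero combination \<open>B\<close> of \<open>R, \<dots>, R^k\<close> with
  \<open>B^2 = 0\<close>; then \<open>tr (x \<mapsto> [B x, b]) = 0\<close> for every \<open>b\<close>, a linear relation between the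
  \<open>\<tau>_j\<close> (lemma \<open>no_double_root\<close>).  Hence \<open>V\<close> has a basis of eigenvectors \<open>v_z\<close> with simple
  nonzero eigenvalues, and the derivation property makes them common eigenvectors of the left
  and right multiplications by elements of \<open>N\<close>.  An element of \<open>N\<close> that annihilates \<open>V\<close> from the
  right is killed by all \<open>\<tau>_j\<close> and so is zero, which yields elements \<open>n_z\<close> of \<open>N\<close> dual to the
  \<open>v_z\<close>.  The Leibniz identity then leaves only one freedom: for each \<open>z\<close> the left action of
  \<open>N\<close> on \<open>v_z\<close> is either zero or minus the right action (lemma \<open>splitting\<close>).  So \<open>lam\<close> is
  isomorphic to one of the \<open>k + 1\<close> algebras of the family.

  (3) The minor in the coordinates \<open>e_l\<close> of the vectors \<open>[a, [e_l, a]]\<close> for \<open>l \<ge> t\<close> and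
  \<open>[a, [e_l, a]] + [[e_l, a], a]\<close> for \<open>l < t\<close>.  The former lie in the span of the \<open>v_z\<close> with
  nonzero left action, the latter in the span of the other \<open>v_z\<close>, so that independence fixes the
  number of eigenvectors of either kind and \<open>lam\<close> is isomorphic to \<open>L_t\<close> itself
  (lemma \<open>orbit_of_nonvanishing\<close>).

  At \<open>L\<close> the first two determinants are of Vandermonde type with nodes \<open>1, \<dots>, k\<close>, and the
  third matrix is diagonal.
\<close>

section \<open>Complex linear and bilinear maps\<close>

text \<open>
  The determinants used below have size \<open>k\<close>, a number rather than a type, hence their source;
  all other matrices and vectors are the Cartesian ones.
\<close>

no_notation vec_index (infixl "$" 100)
hide_const (open) Matrix.mat Matrix.vec Matrix.row Matrix.col Determinant.det

abbreviation clin :: "(complex^'n \<Rightarrow> complex^'n) \<Rightarrow> bool" where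
  "clin f \<equiv> Vector_Spaces.linear (*s) (*s) f"

lemma clinI:
  assumes "\<And>x y. f (x + y) = f x + f y" "\<And>c x. f (c *s x) = c *s f x"
  shows "clin f"
  using assms unfolding Vector_Spaces.linear_iff by (simp add: vec.vector_space_axioms)

lemma clin_add: "clin f \<Longrightarrow> f (x + y) = f x + f y"
  and clin_scale: "clin f \<Longrightarrow> f (c *s x) = c *s f x"
  and clin_diff: "clin f \<Longrightarrow> f (x - y) = f x - f y"
  and clin_zero: "clin f \<Longrightarrow> f 0 = 0"
  and clin_sum: "clin f \<Longrightarrow> f (sum g I) = (\<Sum>i\<in>I. f (g i))"
  by (auto simp: vec.linear_add vec.linear_scale vec.linear_diff vec.linear_0 vec.linear_sum)

lemma clin_compose: "clin f \<Longrightarrow> clin g \<Longrightarrow> clin (\<lambda>x. f (g x))"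
  by (rule clinI) (simp_all add: clin_add clin_scale)

lemma clin_funpow: "clin f \<Longrightarrow> clin (f ^^ j)"
  by (induction j) (auto intro: clinI simp: clin_add clin_scale)

lemma clin_matrix: "clin (\<lambda>x. A *v x)"
  by (rule clinI) (simp_all add: matrix_vector_right_distrib vector_scalar_commute)

lemma clin_basis_expansion: "clin f \<Longrightarrow> f x = (\<Sum>i\<in>UNIV. x $ i *s f (axis i 1))"
  by (metis (no_types, lifting) basis_expansion clin_scale clin_sum sum.cong)

lemma cbil_left: "lam \<in> cbilinear_maps \<Longrightarrow> clin (\<lambda>x. lam x y)"
  and cbil_right: "lam \<in> cbilinear_maps \<Longrightarrow> clin (lam x)"
  unfolding cbilinear_maps_def by auto

lemma cbil_expansion:
  assumes "lam \<in> cbilinear_maps"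
  shows "lam x y $ l = (\<Sum>i\<in>UNIV. \<Sum>j\<in>UNIV. x $ i * y $ j * lam (axis i 1) (axis j 1) $ l)"
proof -
  have "lam x y = (\<Sum>i\<in>UNIV. x $ i *s (\<Sum>j\<in>UNIV. y $ j *s lam (axis i 1) (axis j 1)))"
    using clin_basis_expansion[OF cbil_left[OF assms], of x y]
      clin_basis_expansion[OF cbil_right[OF assms], of _ y] by simp
  then show ?thesis
    by (simp add: sum_distrib_left mult.assoc)
qed

section \<open>Polynomial functions on bilinear maps\<close>

text \<open>
  Polynomial functions are compared on bilinear maps only: there, unlike for arbitrary maps, the
  value \<open>lam x y\<close> is a polynomial in the structure constants for all vectors \<open>x, y\<close>.
\<close>

definition polyfun :: "((complex^'n \<Rightarrow> complex^'n \<Rightarrow> complex^'n) \<Rightarrow> complex) \<Rightarrow> bool" where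
  "polyfun f \<longleftrightarrow> (\<exists>q\<in>poly_funs. \<forall>lam\<in>cbilinear_maps. f lam = q lam)"

lemma polyfun_const: "polyfun (\<lambda>lam. c)"
  unfolding polyfun_def by (rule bexI[OF _ poly_funs.const[of c]]) simp

lemma polyfun_add: "polyfun f \<Longrightarrow> polyfun g \<Longrightarrow> polyfun (\<lambda>lam. f lam + g lam)"
  unfolding polyfun_def by (metis (no_types, lifting) poly_funs.add)

lemma polyfun_mult: "polyfun f \<Longrightarrow> polyfun g \<Longrightarrow> polyfun (\<lambda>lam. f lam * g lam)"
  unfolding polyfun_def by (metis (no_types, lifting) poly_funs.mult)

lemma polyfun_sum: "(\<And>i. i \<in> I \<Longrightarrow> polyfun (f i)) \<Longrightarrow> polyfun (\<lambda>lam. \<Sum>i\<in>I. f i lam)"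
  by (induction I rule: infinite_finite_induct) (auto intro: polyfun_const polyfun_add)

lemma polyfun_prod: "(\<And>i. i \<in> I \<Longrightarrow> polyfun (f i)) \<Longrightarrow> polyfun (\<lambda>lam. \<Prod>i\<in>I. f i lam)"
  by (induction I rule: infinite_finite_induct) (auto intro: polyfun_const polyfun_mult)

text \<open>
  Arguments that are themselves polynomial in \<open>lam\<close> are allowed, so that iterated products such
  as \<open>lam (lam x a) a\<close> have polynomial coordinates.
\<close>

lemma polyfun_apply:
  fixes x y :: "(complex^'n \<Rightarrow> complex^'n \<Rightarrow> complex^'n) \<Rightarrow> complex^'n"
  assumes "\<And>i. polyfun (\<lambda>lam. x lam $ i)" "\<And>i. polyfun (\<lambda>lam. y lam $ i)"
  shows "polyfun (\<lambda>lam. lam (x lam) (y lam) $ l)"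
proof -
  have "polyfun (\<lambda>lam. \<Sum>i\<in>UNIV. \<Sum>j\<in>UNIV.
      x lam $ i * y lam $ j * lam (axis i 1 :: complex^'n) (axis j 1) $ l)"
  proof (intro polyfun_sum polyfun_mult assms)
    show "polyfun (\<lambda>lam. lam (axis i 1 :: complex^'n) (axis j 1) $ l)" for i j
      unfolding polyfun_def by (rule bexI[OF _ poly_funs.coord[of i j l]]) simp
  qed
  then show ?thesis
    unfolding polyfun_def using cbil_expansion[of _ "x _" "y _" l] by simp
qed

lemma polyfun_det:
  assumes "\<And>i j. polyfun (M i j)"
  shows "polyfun (\<lambda>lam. Determinant.det (Matrix.mat k k (\<lambda>(i, j). M i j lam)))"
proof -
  have "Determinant.det (Matrix.mat k k (\<lambda>(i, j). M i j lam)) =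
      (\<Sum>p \<in> {p. p permutes {0..<k}}. signof p * (\<Prod>i = 0..<k. M i (p i) lam))" for lam
  proof -
    have "(\<Prod>i = 0..<k. Matrix.mat k k (\<lambda>(i, j). M i j lam) $$ (i, p i))
        = (\<Prod>i = 0..<k. M i (p i) lam)" if "p permutes {0..<k}" for p
      using permutes_in_image[OF that] by (intro prod.cong) auto
    then show ?thesis
      by (simp add: Determinant.det_def)
  qed
  then show ?thesis
    by (simp add: assms polyfun_const polyfun_mult polyfun_prod polyfun_sum)
qed

section \<open>The action, and orbits that contain a basic open set\<close>

lemma cbil_GL_action:
  assumes "lam \<in> cbilinear_maps"
  shows "GL_action g lam \<in> cbilinear_maps"
  unfolding cbilinear_maps_def GL_action_def
  using cbil_left[OF assms] cbil_right[OF assms]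
  by (auto intro!: clin_compose[OF clin_matrix] clin_compose[OF _ clin_matrix])

lemma matrix_inv_unique:
  fixes A B :: "complex^'n^'n"
  assumes "A ** B = mat 1" "B ** A = mat 1"
  shows "matrix_inv A = B"
proof -
  have "A ** matrix_inv A = mat 1 \<and> matrix_inv A ** A = mat 1"
    unfolding matrix_inv_def using assms by (rule_tac someI_ex) blast
  then show ?thesis
    by (metis assms(2) matrix_mul_assoc matrix_mul_lid matrix_mul_rid)
qed

lemma GL_inverse:
  assumes "g \<in> GL"
  shows "matrix_inv g \<in> GL" "matrix_inv g ** g = mat 1" "g ** matrix_inv g = mat 1"
    "matrix_inv (matrix_inv g) = g"
proof -
  have inv: "invertible g" using assms by (simp add: GL_def)
  show 1: "matrix_inv g ** g = mat 1" "g ** matrix_inv g = mat 1"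
    using inv matrix_inv_unique unfolding invertible_def by metis+
  then show "matrix_inv g \<in> GL"
    unfolding GL_def invertible_def by auto
  show "matrix_inv (matrix_inv g) = g"
    using 1 by (intro matrix_inv_unique)
qed

lemma GL_action_mult:
  assumes "g \<in> GL" "h \<in> GL"
  shows "GL_action g (GL_action h lam) = GL_action (g ** h) lam"
proof -
  have "matrix_inv (g ** h) = matrix_inv h ** matrix_inv g"
  proof (intro matrix_inv_unique)
    show "g ** h ** (matrix_inv h ** matrix_inv g) = mat 1"
      by (metis GL_inverse(3) assms matrix_mul_assoc matrix_mul_rid)
    show "matrix_inv h ** matrix_inv g ** (g ** h) = mat 1"
      by (metis GL_inverse(2) assms matrix_mul_assoc matrix_mul_rid)
  qed
  then show ?thesis
    unfolding GL_action_def by (simp add: matrix_vector_mul_assoc)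
qed

lemma GL_action_inverse:
  assumes "g \<in> GL"
  shows "GL_action (matrix_inv g) (GL_action g lam) = lam"
    "GL_action g (GL_action (matrix_inv g) lam) = lam"
  using assms by (simp_all add: GL_action_mult GL_inverse) (simp_all add: GL_action_def matrix_inv_unique[of "mat 1" "mat 1"])

lemma GL_mult: "g \<in> GL \<Longrightarrow> h \<in> GL \<Longrightarrow> g ** h \<in> GL"
  by (simp add: GL_def invertible_mult)

lemma Leib_GL_action:
  assumes "lam \<in> Leib" "g \<in> GL"
  shows "GL_action g lam \<in> Leib"
proof -
  have cb: "lam \<in> cbilinear_maps" using assms by (simp add: Leib_def)
  have [simp]: "matrix_inv g *v (g *v x) = x" for x
    by (simp add: matrix_vector_mul_assoc GL_inverse assms)
  have "lam x (lam y z) = lam (lam x y) z - lam (lam x z) y" for x y z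
    using assms(1) by (simp add: Leib_def)
  then show ?thesis
    unfolding Leib_def using cbil_GL_action[OF cb]
    by (simp add: GL_action_def matrix_vector_mult_diff_distrib)
qed

lemma Orb_GL_action:
  assumes "lam \<in> Orb L" "g \<in> GL"
  shows "GL_action g lam \<in> Orb L"
  using assms unfolding Orb_def by (auto simp: GL_action_mult GL_mult)

lemma polyfun_GL_action:
  assumes "polyfun f"
  shows "polyfun (\<lambda>lam. f (GL_action g lam))"
proof -
  have "polyfun (\<lambda>lam. q (GL_action g lam))" if "q \<in> poly_funs" for q
    using that
  proof induction
    case (coord i j l)
    show ?case
      unfolding GL_action_def matrix_vector_mult_def
      by (simp add: polyfun_sum polyfun_mult polyfun_const polyfun_apply)
  qed (auto intro: polyfun_const polyfun_add polyfun_mult)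
  then show ?thesis
    using assms cbil_GL_action unfolding polyfun_def by metis
qed

text \<open>
  The basic open set need not be stable under the action: each point of the orbit is moved into it
  by some \<open>g\<close>, and \<open>polyfun_GL_action\<close> makes the translates open.
\<close>

lemma rigid_if_basic_open:
  assumes L: "L \<in> Leib" and f: "polyfun f" and nz: "f L \<noteq> 0"
    and orb: "\<And>lam. lam \<in> Leib \<Longrightarrow> f lam \<noteq> 0 \<Longrightarrow> lam \<in> Orb L"
  shows "rigid L"
proof -
  define D where "D g = {lam \<in> cbilinear_maps. f (GL_action g lam) \<noteq> 0}" for g
  have "openin zariski_topology (D g)" for g
  proof -
    obtain q where q: "q \<in> poly_funs" "\<And>lam. lam \<in> cbilinear_maps \<Longrightarrow> f (GL_action g lam) = q lam"
      using polyfun_GL_action[OF f, of g] unfolding polyfun_def by blast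
    then have "cbilinear_maps - D g = zero_locus {q}"
      unfolding D_def zero_locus_def by auto
    then show ?thesis
      using q(1) unfolding openin_zariski_topology zariski_closed_def D_def by blast
  qed
  then have op: "openin zariski_topology (\<Union>g\<in>GL. D g)"
    by blast
  have "Orb L = (\<Union>g\<in>GL. D g) \<inter> Leib"
  proof (intro equalityI subsetI)
    fix lam assume "lam \<in> Orb L"
    then obtain g where g: "g \<in> GL" and lam: "lam = GL_action g L"
      unfolding Orb_def by blast
    have "lam \<in> Leib" using Leib_GL_action[OF L g] lam by simp
    moreover from this have "lam \<in> D (matrix_inv g)"
      using nz unfolding D_def lam by (simp add: GL_action_inverse[OF g] Leib_def)
    ultimately show "lam \<in> (\<Union>g\<in>GL. D g) \<inter> Leib"
      using GL_inverse(1)[OF g] by blast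
  next
    fix lam assume "lam \<in> (\<Union>g\<in>GL. D g) \<inter> Leib"
    then obtain g where g: "g \<in> GL" and "lam \<in> D g" and lam: "lam \<in> Leib"
      by blast
    then have "GL_action g lam \<in> Orb L"
      using orb[OF Leib_GL_action[OF lam g]] by (simp add: D_def)
    then show "lam \<in> Orb L"
      using Orb_GL_action[OF _ GL_inverse(1)[OF g]] GL_action_inverse(1)[OF g] by metis
  qed
  then show ?thesis
    unfolding rigid_def openin_subtopology using L op by blast
qed

section \<open>Linear algebra\<close>

lemma det_nonzero_iff_cols:
  fixes M :: "nat \<Rightarrow> nat \<Rightarrow> complex"
  shows "Determinant.det (Matrix.mat k k (\<lambda>(i, j). M i j)) \<noteq> 0 \<longleftrightarrow>
    (\<forall>q. (\<forall>i<k. (\<Sum>j<k. q j * M i j) = 0) \<longrightarrow> (\<forall>j<k. q j = 0))"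
    (is "?D \<noteq> 0 \<longleftrightarrow> ?R")
proof -
  let ?A = "Matrix.mat k k (\<lambda>(i, j). M i j)"
  have A: "?A \<in> carrier_mat k k" by simp
  have prod: "?A *\<^sub>v Matrix.vec k q = 0\<^sub>v k \<longleftrightarrow> (\<forall>i<k. (\<Sum>j<k. q j * M i j) = 0)" for q
    by (auto simp: vec_eq_iff scalar_prod_def mult.commute atLeast0LessThan)
  have zero: "Matrix.vec k q = 0\<^sub>v k \<longleftrightarrow> (\<forall>j<k. q j = 0)" for q :: "nat \<Rightarrow> complex"
    by (auto simp: vec_eq_iff)
  have "?D = 0 \<longleftrightarrow> (\<exists>v\<in>carrier_vec k. v \<noteq> 0\<^sub>v k \<and> ?A *\<^sub>v v = 0\<^sub>v k)"
    using det_0_iff_vec_prod_zero[OF A] by auto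
  also have "\<dots> \<longleftrightarrow> (\<exists>q. Matrix.vec k q \<noteq> 0\<^sub>v k \<and> ?A *\<^sub>v Matrix.vec k q = 0\<^sub>v k)"
  proof -
    have "\<exists>q. v = Matrix.vec k q" if "v \<in> carrier_vec k" for v :: "complex Matrix.vec"
      using that by (intro exI[of _ "vec_index v"] eq_vecI) auto
    then show ?thesis by (metis vec_carrier)
  qed
  finally show ?thesis
    unfolding prod zero by blast
qed

lemma det_nonzero_iff_rows:
  fixes M :: "nat \<Rightarrow> nat \<Rightarrow> complex"
  shows "Determinant.det (Matrix.mat k k (\<lambda>(i, j). M i j)) \<noteq> 0 \<longleftrightarrow>
    (\<forall>q. (\<forall>j<k. (\<Sum>i<k. q i * M i j) = 0) \<longrightarrow> (\<forall>i<k. q i = 0))"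
proof -
  have "transpose_mat (Matrix.mat k k (\<lambda>(i, j). M j i)) = Matrix.mat k k (\<lambda>(i, j). M i j)"
    by (rule eq_matI) auto
  then have "Determinant.det (Matrix.mat k k (\<lambda>(i, j). M i j))
      = Determinant.det (Matrix.mat k k (\<lambda>(i, j). M j i))"
    using Determinant.det_transpose[of "Matrix.mat k k (\<lambda>(i, j). M j i)" k] by simp
  then show ?thesis
    using det_nonzero_iff_cols[of k "\<lambda>i j. M j i"] by simp
qed

definition lin_indep :: "'i set \<Rightarrow> ('i \<Rightarrow> complex^'n) \<Rightarrow> bool" where
  "lin_indep I w \<longleftrightarrow> (\<forall>q. (\<Sum>i\<in>I. q i *s w i) = 0 \<longrightarrow> (\<forall>i\<in>I. q i = 0))"

lemma lin_indepD: "lin_indep I w \<Longrightarrow> (\<Sum>i\<in>I. q i *s w i) = 0 \<Longrightarrow> i \<in> I \<Longrightarrow> q i = 0"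
  unfolding lin_indep_def by blast

lemma lin_indep_imp_independent:
  assumes "finite I" "lin_indep I w"
  shows "inj_on w I" "vec.independent (w ` I)"
proof -
  show inj: "inj_on w I"
  proof (rule inj_onI, rule ccontr)
    fix i j assume ij: "i \<in> I" "j \<in> I" "w i = w j" "i \<noteq> j"
    let ?q = "\<lambda>l. if l = i then 1 else if l = j then -1 else (0::complex)"
    have "(\<Sum>l\<in>I. ?q l *s w l) = (\<Sum>l\<in>{i,j}. ?q l *s w l)"
      using assms(1) ij by (intro sum.mono_neutral_right) auto
    also have "\<dots> = 0" using ij by simp
    finally have "?q i = 0" by (rule lin_indepD[OF assms(2) _ ij(1)])
    then show False by simp
  qed
  show "vec.independent (w ` I)"
  proof
    assume "vec.dependent (w ` I)"
    then obtain c where c: "\<exists>x\<in>w ` I. c x \<noteq> 0" "(\<Sum>x\<in>w ` I. c x *s x) = 0"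
      using vec.dependent_finite[of "w ` I"] assms(1) by auto
    have "(\<Sum>i\<in>I. c (w i) *s w i) = 0"
      using c(2) by (simp add: sum.reindex[OF inj])
    then have "\<forall>i\<in>I. c (w i) = 0" using lin_indepD[OF assms(2), of "\<lambda>i. c (w i)"] by blast
    then show False using c(1) by blast
  qed
qed

lemma lin_indep_card_le:
  fixes w :: "'i \<Rightarrow> complex^'n"
  assumes "finite I" "lin_indep I w" "finite J" "\<And>i. i \<in> I \<Longrightarrow> w i \<in> vec.span (v ` J)"
  shows "card I \<le> card J"
proof -
  note w = lin_indep_imp_independent[OF assms(1,2)]
  have "card (w ` I) \<le> card (v ` J)"
    using vec.independent_span_bound[of "v ` J" "w ` I"] w(2) assms(3,4) by blast
  also have "\<dots> \<le> card J" using assms(3) by (rule card_image_le)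
  finally show ?thesis using card_image[OF w(1)] by simp
qed

text \<open>
  A direct-sum form of dimension counting: two families that together are independent and number
  \<open>CARD('n)\<close> span the space.  Keeping the families apart permits reading off the component in each.
\<close>

lemma lin_indep_pair_spans:
  fixes w :: "'i \<Rightarrow> complex^'n" and h :: "'j \<Rightarrow> complex^'n"
  assumes fin: "finite I" "finite J" and card: "card I + card J = CARD('n)"
    and ind: "\<And>q r. (\<Sum>i\<in>I. q i *s w i) + (\<Sum>j\<in>J. r j *s h j) = 0
        \<Longrightarrow> (\<forall>i\<in>I. q i = 0) \<and> (\<forall>j\<in>J. r j = 0)"
  obtains q r where "x = (\<Sum>i\<in>I. q i *s w i) + (\<Sum>j\<in>J. r j *s h j)"
proof -
  let ?K = "I <+> J" and ?f = "case_sum w h"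
  have split: "(\<Sum>i\<in>?K. q i *s ?f i) = (\<Sum>i\<in>I. q (Inl i) *s w i) + (\<Sum>j\<in>J. q (Inr j) *s h j)" for q
    using fin by (simp add: sum.Plus)
  have ind': "lin_indep ?K ?f"
    unfolding lin_indep_def split
  proof (intro allI impI)
    fix q assume "(\<Sum>i\<in>I. q (Inl i) *s w i) + (\<Sum>j\<in>J. q (Inr j) *s h j) = 0"
    from ind[OF this] show "\<forall>i\<in>?K. q i = 0" by auto
  qed
  have finK: "finite ?K" using fin by simp
  note K = lin_indep_imp_independent[OF finK ind']
  have "card (?f ` ?K) = CARD('n)"
    using card_image[OF K(1)] card_Plus[OF fin] card by simp
  then have "UNIV \<subseteq> vec.span (?f ` ?K)"
    using vec.card_ge_dim_independent[OF subset_UNIV K(2)] by (simp add: vec_dim_card card_cart_basis)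
  then obtain c where "x = (\<Sum>y\<in>?f ` ?K. c y *s y)"
    using vec.span_finite[of "?f ` ?K"] finK by auto
  then have "x = (\<Sum>i\<in>?K. c (?f i) *s ?f i)"
    by (simp add: sum.reindex[OF K(1)])
  then show thesis
    unfolding split using that[of "\<lambda>i. c (w i)" "\<lambda>j. c (h j)"] by simp
qed

definition ctr :: "(complex^'n \<Rightarrow> complex^'n) \<Rightarrow> complex" where
  "ctr f = (\<Sum>i\<in>UNIV. f (axis i 1) $ i)"

lemma ctr_add: "ctr (\<lambda>x. f x + g x) = ctr f + ctr g"
  unfolding ctr_def by (simp add: sum.distrib)

lemma ctr_diff: "ctr (\<lambda>x. f x - g x) = ctr f - ctr g"
  unfolding ctr_def by (simp add: sum_subtractf)

lemma ctr_scale: "ctr (\<lambda>x. c *s f x) = c * ctr f"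
  unfolding ctr_def by (simp add: sum_distrib_left)

lemma ctr_zero: "ctr (\<lambda>x. 0) = 0"
  unfolding ctr_def by simp

lemma ctr_sum: "ctr (\<lambda>x. \<Sum>i\<in>I. G i x) = (\<Sum>i\<in>I. ctr (G i))"
  by (induction I rule: infinite_finite_induct) (simp_all add: ctr_zero ctr_add)

lemma ctr_commute:
  assumes "clin f" "clin g"
  shows "ctr (\<lambda>x. f (g x)) = ctr (\<lambda>x. g (f x))"
proof -
  have *: "ctr (\<lambda>x. f (g x)) = (\<Sum>i\<in>UNIV. \<Sum>j\<in>UNIV. g (axis i 1) $ j * f (axis j 1) $ i)"
    if "clin f" for f g :: "complex^'n \<Rightarrow> complex^'n"
    unfolding ctr_def by (subst clin_basis_expansion[OF that]) simp
  show ?thesis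
    unfolding *[OF assms(1)] *[OF assms(2)] by (subst sum.swap) (simp add: mult.commute)
qed

text \<open>
  A linear map has a generalised inverse \<open>g\<close> with \<open>f g f = f\<close>; hence
  \<open>tr f = tr (f g f) = tr (g f f) = 0\<close>.
\<close>

lemma ctr_square_zero:
  assumes f: "clin f" and sq: "\<And>x. f (f x) = 0"
  shows "ctr f = 0"
proof -
  obtain g where g: "clin g" and fg: "\<forall>v\<in>range f. f (g v) = v"
    using vec.linear_exists_right_inverse_on[OF f vec.subspace_UNIV] by blast
  have "ctr f = ctr (\<lambda>x. f (g (f x)))" using fg by simp
  also have "\<dots> = ctr (\<lambda>x. g (f (f x)))"
    using ctr_commute[OF f clin_compose[OF g f]] by simp
  also have "\<dots> = 0" using sq clin_zero[OF g] by (simp add: ctr_zero)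
  finally show ?thesis .
qed

text \<open>
  The \<open>complex poly\<close>-module structure on the space in which the indeterminate acts as \<open>f\<close>.
\<close>

definition act :: "(complex^'n \<Rightarrow> complex^'n) \<Rightarrow> complex poly \<Rightarrow> complex^'n \<Rightarrow> complex^'n" where
  "act f p x = (\<Sum>i\<le>degree p. coeff p i *s (f ^^ i) x)"

lemma act_eq_sum:
  assumes "degree p < n"
  shows "act f p x = (\<Sum>i<n. coeff p i *s (f ^^ i) x)"
  unfolding act_def using assms
  by (intro sum.mono_neutral_left) (auto simp: coeff_eq_0)

lemma act_0: "act f 0 x = 0"
  by (simp add: act_def)

lemma act_add: "act f (p + q) x = act f p x + act f q x"
proof -
  define n where "n = Suc (max (degree p) (degree q))"
  have "degree (p + q) < n" "degree p < n" "degree q < n"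
    by (auto simp: n_def degree_add_le le_imp_less_Suc)
  then show ?thesis
    by (simp add: act_eq_sum vec.scale_left_distrib sum.distrib)
qed

lemma act_smult: "act f (Polynomial.smult c p) x = c *s act f p x"
proof -
  define n where "n = Suc (degree p)"
  have "degree (Polynomial.smult c p) < n" "degree p < n"
    by (auto simp: n_def)
  then show ?thesis
    by (simp add: act_eq_sum vec.scale_sum_right)
qed

lemma act_pCons:
  assumes "clin f"
  shows "act f (pCons c p) x = c *s x + f (act f p x)"
proof -
  have "degree (pCons c p) < Suc (Suc (degree p))" by (simp add: degree_pCons_le le_imp_less_Suc)
  then have "act f (pCons c p) x = (\<Sum>i<Suc (Suc (degree p)). coeff (pCons c p) i *s (f ^^ i) x)"
    by (rule act_eq_sum)
  also have "\<dots> = c *s x + (\<Sum>i<Suc (degree p). coeff p i *s f ((f ^^ i) x))"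
    by (simp add: sum.lessThan_Suc_shift del: sum.lessThan_Suc)
  also have "(\<Sum>i<Suc (degree p). coeff p i *s f ((f ^^ i) x)) = f (act f p x)"
    using act_eq_sum[of p "Suc (degree p)" f x]
    by (simp add: clin_sum[OF assms] clin_scale[OF assms] clin_add[OF assms])
  finally show ?thesis .
qed

lemma clin_act: "clin f \<Longrightarrow> clin (act f p)"
  unfolding act_def
  by (rule clinI)
    (simp_all add: clin_add[OF clin_funpow] clin_scale[OF clin_funpow] vec.scale_right_distrib
      sum.distrib vec.scale_sum_right mult.commute)

lemma act_mult: "clin f \<Longrightarrow> act f (p * q) x = act f p (act f q x)"
  by (induction p) (simp_all add: act_0 act_add act_smult act_pCons)

lemma act_commute: "clin f \<Longrightarrow> act f p (act f q x) = act f q (act f p x)"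
  by (metis act_mult mult.commute)

lemma act_self: "clin f \<Longrightarrow> act f p (f x) = f (act f p x)"
  using act_commute[of f p "[:0, 1:]" x] by (simp add: act_pCons act_0 clin_zero)

lemma act_eigenvector:
  assumes "clin f" "f x = c *s x"
  shows "act f p x = poly p c *s x"
  by (induction p) (simp_all add: act_0 act_pCons clin_scale assms vec.scale_left_distrib mult.commute)

lemma act_intertwine:
  assumes "clin f" "clin g" "\<And>x. g (f x) = f (g x)"
  shows "g (act f p x) = act f p (g x)"
  by (induction p) (simp_all add: act_0 act_pCons assms clin_zero clin_add clin_scale)

section \<open>Splitting a Leibniz algebra by one right multiplication\<close>

lemma exists_poly_with_coeffs:
  assumes "0 < k"
  obtains q :: "complex poly" where "degree q < k" "\<And>i. i < k \<Longrightarrow> coeff q i = c i"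
proof
  let ?q = "\<Sum>j<k. Polynomial.monom (c j) j"
  have co: "coeff ?q i = (if i < k then c i else 0)" for i
    by (auto simp: coeff_sum coeff_monom sum.delta)
  then show "coeff ?q i = c i" if "i < k" for i using that by simp
  show "degree ?q < k"
    using assms co by (intro degree_lessI) auto
qed

lemma card_roots_eq_degree:
  fixes p :: "complex poly"
  assumes p0: "p \<noteq> 0" and simple: "\<And>z g. p \<noteq> [:-z, 1:] * ([:-z, 1:] * g)"
  shows "card {z. poly p z = 0} = degree p"
proof -
  have "order z p \<le> 1" for z
  proof (rule ccontr)
    assume "\<not> order z p \<le> 1"
    then have "[:-z, 1:] ^ 2 dvd p" using order_divides[of z 2 p] by simp
    then obtain g where "p = [:-z, 1:] ^ 2 * g" by (rule dvdE)
    then show False using simple[of z g] by (simp only: power2_eq_square mult.assoc)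
  qed
  then have "rsquarefree p" unfolding rsquarefree_def using p0 by (metis le_numeral_extra(4) less_one nat_less_le)
  from complex_poly_decompose_rsquarefree[OF this]
  have "degree p = degree (\<Prod>z | poly p z = 0. [:- z, 1:])"
    using p0 by (metis degree_smult_eq leading_coeff_0_iff)
  also have "\<dots> = card {z. poly p z = 0}"
    by (subst degree_prod_eq_sum_degree) auto
  finally show ?thesis by simp
qed

text \<open>
  The open conditions (1) and (2) of the introduction.  Nonsingularity of the trace matrix is
  stated once for its rows, which makes the functionals \<open>\<tau>_j\<close> independent, and once for its
  columns, which makes the \<open>h_l\<close> independent modulo the common kernel of the \<open>\<tau>_j\<close>.
\<close>

locale split_leibniz =
  fixes lam :: "complex^'n \<Rightarrow> complex^'n \<Rightarrow> complex^'n" and a u :: "complex^'n"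
    and h :: "nat \<Rightarrow> complex^'n" and k :: nat
  assumes lam: "lam \<in> Leib" and card_k: "CARD('n) = 2 * k"
    and cyclic: "lin_indep {..<k} (\<lambda>j. ((\<lambda>x. lam x a) ^^ (j + 2)) u)"
    and trace_rows: "\<And>q. (\<And>l. l < k \<Longrightarrow>
        (\<Sum>j<k. q j * ctr (\<lambda>x. lam (((\<lambda>x. lam x a) ^^ Suc j) x) (h l))) = 0) \<Longrightarrow> \<forall>j<k. q j = 0"
    and trace_cols: "\<And>q. (\<And>j. j < k \<Longrightarrow>
        (\<Sum>l<k. q l * ctr (\<lambda>x. lam (((\<lambda>x. lam x a) ^^ Suc j) x) (h l))) = 0) \<Longrightarrow> \<forall>l<k. q l = 0"
begin

definition "R = (\<lambda>x. lam x a)"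

definition "\<tau> j b = ctr (\<lambda>x. lam ((R ^^ Suc j) x) b)"

text \<open>
  It turns out that \<open>V\<close> is the image of \<open>R\<close> (\<open>R_in_V\<close>, \<open>V_range\<close>).  Defining it by the trace
  functionals makes the upper bound on its dimension immediate.
\<close>

definition "V = {x. \<forall>j<k. \<tau> j x = 0}"

definition "N = {x. R x = 0}"

lemma k_pos: "0 < k"
  using card_k by (metis mult_0_right neq0_conv zero_less_card_finite)

lemma lam_cbil: "lam \<in> cbilinear_maps"
  using lam by (simp add: Leib_def)

lemmas linl = cbil_left[OF lam_cbil] and linr = cbil_right[OF lam_cbil]

lemmas lam_simps =
  clin_add[OF linl] clin_add[OF linr] clin_scale[OF linl] clin_scale[OF linr]
  clin_diff[OF linl] clin_diff[OF linr] clin_zero[OF linl] clin_zero[OF linr]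
  clin_sum[OF linl] clin_sum[OF linr]

lemma leib: "lam x (lam y z) = lam (lam x y) z - lam (lam x z) y"
  using lam by (simp add: Leib_def)

lemma linR: "clin R"
  unfolding R_def by (rule linl)

lemmas R_simps = clin_add[OF linR] clin_scale[OF linR] clin_diff[OF linR] clin_zero[OF linR]
  clin_sum[OF linR]

lemma R_deriv: "R (lam x y) = lam (R x) y + lam x (R y)"
  unfolding R_def using leib[of x y a] by simp

lemma tau_add: "\<tau> j (x + y) = \<tau> j x + \<tau> j y"
  and tau_scale: "\<tau> j (c *s x) = c * \<tau> j x"
  and tau_zero: "\<tau> j 0 = 0"
  unfolding \<tau>_def by (simp_all only: lam_simps ctr_add ctr_scale ctr_zero)

lemma tau_sum: "\<tau> j (sum g I) = (\<Sum>i\<in>I. \<tau> j (g i))"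
  by (induction I rule: infinite_finite_induct) (simp_all add: tau_add tau_zero)

lemma V_add: "x \<in> V \<Longrightarrow> y \<in> V \<Longrightarrow> x + y \<in> V"
  and V_scale: "x \<in> V \<Longrightarrow> c *s x \<in> V"
  and V_zero: "0 \<in> V"
  by (simp_all add: V_def tau_add tau_scale tau_zero)

lemma V_sum: "(\<And>i. i \<in> I \<Longrightarrow> g i \<in> V) \<Longrightarrow> sum g I \<in> V"
  by (simp add: V_def tau_sum)

lemma V_diff: "x \<in> V \<Longrightarrow> y \<in> V \<Longrightarrow> x - y \<in> V"
  using V_add[of x "(-1) *s y"] V_scale[of y "-1"] by simp

lemma N_sum: "(\<And>i. i \<in> I \<Longrightarrow> g i \<in> N) \<Longrightarrow> sum g I \<in> N"
  by (simp add: N_def R_simps)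

lemma N_scale: "x \<in> N \<Longrightarrow> c *s x \<in> N"
  by (simp add: N_def R_simps)

text \<open>
  Right multiplication by \<open>R x = lam x a\<close> is the commutator of \<open>R\<close> with right multiplication by
  \<open>x\<close>, so its product with anything commuting with \<open>R\<close> has trace zero.
\<close>

lemma trace_commutator:
  assumes B: "clin B" and com: "\<And>x. R (B x) = B (R x)"
  shows "ctr (\<lambda>y. lam (B y) (R x)) = 0"
proof -
  have "ctr (\<lambda>y. lam (B y) (R x)) = ctr (\<lambda>y. R (lam (B y) x) - lam (R (B y)) x)"
    using leib[of _ x a] by (simp add: R_def)
  also have "\<dots> = ctr (\<lambda>y. R (lam (B y) x)) - ctr (\<lambda>y. lam (R (B y)) x)"
    by (rule ctr_diff)
  also have "ctr (\<lambda>y. R (lam (B y) x)) = ctr (\<lambda>y. lam (B (R y)) x)"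
    using ctr_commute[OF linR clin_compose[OF linl B]] .
  finally show ?thesis by (simp add: com)
qed

lemma R_in_V: "R x \<in> V"
  unfolding V_def \<tau>_def
  using trace_commutator[OF clin_funpow[OF linR]] by (simp add: funpow_swap1 del: funpow.simps)

lemma comb_h_in_V:
  assumes "(\<Sum>l<k. r l *s h l) \<in> V"
  shows "\<forall>l<k. r l = 0"
proof (rule trace_cols)
  fix j assume "j < k"
  then have "\<tau> j (\<Sum>l<k. r l *s h l) = 0" using assms by (simp add: V_def)
  then show "(\<Sum>l<k. r l * ctr (\<lambda>x. lam (((\<lambda>x. lam x a) ^^ Suc j) x) (h l))) = 0"
    by (simp only: tau_sum tau_scale) (simp only: \<tau>_def R_def)
qed

text \<open>
  The \<open>h_l\<close> are independent modulo \<open>V\<close>, so \<open>V\<close> has dimension at most \<open>k\<close>, and any \<open>k\<close> independent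
  vectors of \<open>V\<close> span it.
\<close>

lemma V_spanned:
  assumes "finite I" "card I = k" "\<And>i. i \<in> I \<Longrightarrow> w i \<in> V" "lin_indep I w" "x \<in> V"
  obtains q where "x = (\<Sum>i\<in>I. q i *s w i)"
proof -
  have comb: "(\<Sum>i\<in>I. q i *s w i) \<in> V" for q
    by (intro V_sum V_scale assms)
  obtain q r where x: "x = (\<Sum>i\<in>I. q i *s w i) + (\<Sum>l\<in>{..<k}. r l *s h l)"
  proof (rule lin_indep_pair_spans[of I "{..<k}" w h x])
    fix q r assume 0: "(\<Sum>i\<in>I. q i *s w i) + (\<Sum>l\<in>{..<k}. r l *s h l) = 0"
    then have "(\<Sum>l<k. r l *s h l) = 0 - (\<Sum>i\<in>I. q i *s w i)"
      by (simp add: add_eq_0_iff)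
    then have "\<forall>l<k. r l = 0"
      by (metis comb_h_in_V V_diff V_zero comb)
    with 0 show "(\<forall>i\<in>I. q i = 0) \<and> (\<forall>j\<in>{..<k}. r j = 0)"
      using lin_indepD[OF assms(4)] by simp
  qed (use assms card_k in auto)
  then have "(\<Sum>l<k. r l *s h l) = x - (\<Sum>i\<in>I. q i *s w i)"
    by simp
  then have "\<forall>l<k. r l = 0"
    by (metis comb_h_in_V V_diff comb assms(5))
  with x that show thesis by simp
qed

lemma cyclic_shift: "lin_indep {..<k} (\<lambda>j. (R ^^ (j + 1)) u)"
  unfolding lin_indep_def
proof (intro allI impI)
  fix q assume "(\<Sum>j<k. q j *s (R ^^ (j + 1)) u) = 0"
  then have "R (\<Sum>j<k. q j *s (R ^^ (j + 1)) u) = 0" by (simp only: R_simps)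
  then have "(\<Sum>j<k. q j *s (R ^^ (j + 2)) u) = 0" by (simp add: R_simps)
  then show "\<forall>j\<in>{..<k}. q j = 0"
    using cyclic by (auto simp: R_def lin_indep_def)
qed

lemma V_cyclic:
  assumes "x \<in> V"
  obtains q where "degree q < k" "x = act R q (R u)"
proof -
  obtain c where c: "x = (\<Sum>j<k. c j *s (R ^^ (j + 1)) u)"
    using V_spanned[OF _ _ _ cyclic_shift assms] R_in_V by auto
  obtain q where q: "degree q < k" "\<And>i. i < k \<Longrightarrow> coeff q i = c i"
    using exists_poly_with_coeffs[OF k_pos, of c] by blast
  have "x = act R q (R u)"
    unfolding c act_eq_sum[OF q(1)] by (intro sum.cong) (simp_all add: q(2) funpow_swap1)
  with q(1) that show thesis by blast
qed

text \<open>
  The minimal polynomial of the cyclic vector has degree \<open>k\<close>, even after one more application of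
  \<open>R\<close>; the latter says that zero is not an eigenvalue of \<open>R\<close> on \<open>V\<close>.
\<close>

lemma act_inj2:
  assumes "degree q < k" "act R q (R (R u)) = 0"
  shows "q = 0"
proof -
  have "(\<Sum>j<k. coeff q j *s (R ^^ (j + 2)) u) = 0"
    using assms(2) unfolding act_eq_sum[OF assms(1)] by (simp add: funpow_swap1)
  then have "coeff q i = 0" if "i < k" for i
    using lin_indepD[OF cyclic, of "coeff q" i] that by (simp add: R_def)
  then show ?thesis
    using assms(1) by (metis leading_coeff_0_iff)
qed

lemma act_inj:
  assumes "degree q < k" "act R q (R u) = 0"
  shows "q = 0"
  using act_inj2[OF assms(1)] act_self[OF linR, of q "R u"] assms(2) by (simp add: R_simps)

lemma V_range:
  assumes "x \<in> V" obtains y where "y \<in> V" "x = R y"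
proof -
  obtain q where q: "x = (\<Sum>j<k. q j *s (R ^^ (j + 2)) u)"
    using V_spanned[OF _ _ _ cyclic[folded R_def] assms] R_in_V by auto
  have "x = R (\<Sum>j<k. q j *s (R ^^ (j + 1)) u)"
    unfolding q by (simp add: R_simps)
  moreover have "(\<Sum>j<k. q j *s (R ^^ (j + 1)) u) \<in> V"
    using R_in_V by (intro V_sum V_scale) simp
  ultimately show thesis using that by blast
qed

lemma V_Int_N: "x \<in> V \<Longrightarrow> x \<in> N \<Longrightarrow> x = 0"
proof -
  assume "x \<in> V" "x \<in> N"
  then obtain q where q: "degree q < k" "x = act R q (R u)" by (rule_tac V_cyclic)
  have "act R q (R (R u)) = 0"
    using \<open>x \<in> N\<close> q(2) act_self[OF linR] by (simp add: N_def)
  then show ?thesis using act_inj2[OF q(1)] q(2) by (simp add: act_0)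
qed

lemma V_plus_N: obtains v m where "v \<in> V" "m \<in> N" "x = v + m"
proof -
  obtain v where v: "v \<in> V" "R x = R v" using V_range[OF R_in_V] .
  then have "x - v \<in> N" by (simp add: N_def R_simps)
  with v that[of v "x - v"] show thesis by simp
qed

lemma annihilating_poly:
  obtains p where "degree p = k" "\<And>x. act R p (R x) = 0"
proof -
  have "(R ^^ Suc k) u \<in> V" using R_in_V by simp
  then obtain r where r: "degree r < k" "(R ^^ Suc k) u = act R r (R u)" by (rule V_cyclic)
  let ?m = "Polynomial.monom 1 k :: complex poly" 
  let ?p = "?m + Polynomial.smult (-1) r"
  have m: "act R ?m x = (R ^^ k) x" for x
    by (simp add: act_def degree_monom_eq if_distrib[of "\<lambda>c. c *s _"] cong: if_cong)
  have deg: "degree ?p = k"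
    using r(1) by (subst degree_add_eq_left) (auto simp: degree_monom_eq)
  have pu: "act R ?p (R u) = 0"
    using r(2) by (simp only: act_add act_smult m) (simp add: funpow_swap1)
  have "act R ?p (R x) = 0" for x
  proof -
    obtain q where "R x = act R q (R u)" using V_cyclic[OF R_in_V] .
    then show ?thesis
      using act_commute[OF linR, of ?p q "R u"] pu clin_zero[OF clin_act[OF linR]] by simp
  qed
  with deg that show thesis by blast
qed

text \<open>
  Suppose \<open>p = (T - z)^2 g\<close> and put \<open>B = (R - z) g(R) R\<close>.  Then \<open>B\<close> is a combination of
  \<open>R, \<dots>, R^k\<close> with \<open>B^2 = 0\<close>.  Consider the trace of \<open>B\<close> followed by right multiplication by
  \<open>b\<close>.  For \<open>b\<close> in \<open>V\<close> it vanishes by \<open>trace_commutator\<close>.  For \<open>b\<close> in \<open>N\<close> right multiplication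
  by \<open>b\<close> commutes with \<open>R\<close>, hence with \<open>B\<close>, and the product again squares to zero.  So the
  coefficients of \<open>B\<close> form a linear relation between the \<open>\<tau>_j\<close>.
\<close>

lemma no_double_root:
  assumes deg: "degree p = k" and p: "\<And>x. act R p (R x) = 0"
  shows "p \<noteq> [:-z, 1:] * ([:-z, 1:] * g)"
proof
  assume eq: "p = [:-z, 1:] * ([:-z, 1:] * g)"
  define s where "s = [:-z, 1:] * g"
  define B where "B x = act R s (R x)" for x
  have p0: "p \<noteq> 0" using deg k_pos by auto
  then have s0: "s \<noteq> 0" using eq by (auto simp: s_def)
  have "degree p = 1 + degree s"
    unfolding eq s_def[symmetric] using s0 by (subst degree_mult_eq) auto
  then have degs: "degree s < k" using deg by simp
  have linB: "clin B" unfolding B_def by (rule clin_compose[OF clin_act[OF linR] linR])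
  have RB: "R (B x) = B (R x)" for x
    unfolding B_def by (simp add: act_self[OF linR])
  have BB: "B (B x) = 0" for x
  proof -
    have "B (B x) = act R (s * s) (R (R x))"
      unfolding B_def by (simp add: act_mult[OF linR] act_self[OF linR])
    also have "s * s = g * p" unfolding s_def eq by (simp only: mult_ac)
    also have "act R (g * p) (R (R x)) = 0"
      by (simp add: act_mult[OF linR] p clin_zero[OF clin_act[OF linR]])
    finally show ?thesis .
  qed
  have tr0: "ctr (\<lambda>x. lam (B x) b) = 0" for b
  proof -
    obtain v m where vm: "v \<in> V" "m \<in> N" "b = v + m" using V_plus_N .
    obtain y where y: "v = R y" using V_range[OF vm(1)] .
    have Rm: "R m = 0" using vm(2) by (simp add: N_def)
    have com: "lam (R x) m = R (lam x m)" for x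
      by (simp add: R_deriv Rm lam_simps)
    have "lam (B x) m = B (lam x m)" for x
      unfolding B_def using act_intertwine[OF linR linl com] com by simp
    then have "lam (B (lam (B x) m)) m = 0" for x
      by (simp add: BB lam_simps)
    then have "ctr (\<lambda>x. lam (B x) m) = 0"
      using ctr_square_zero[OF clin_compose[OF linl linB]] by simp
    moreover have "ctr (\<lambda>x. lam (B x) v) = 0"
      unfolding y by (rule trace_commutator[OF linB RB])
    ultimately show ?thesis
      unfolding vm(3) by (simp add: lam_simps ctr_add)
  qed
  have "\<forall>j<k. coeff s j = 0"
  proof (rule trace_rows)
    fix l
    have "ctr (\<lambda>x. lam (B x) (h l)) = (\<Sum>j<k. coeff s j * \<tau> j (h l))"
      unfolding B_def act_eq_sum[OF degs] \<tau>_def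
      by (simp add: lam_simps ctr_sum ctr_scale funpow_swap1)
    then show "(\<Sum>j<k. coeff s j * ctr (\<lambda>x. lam (((\<lambda>x. lam x a) ^^ Suc j) x) (h l))) = 0"
      using tr0 unfolding \<tau>_def R_def by simp
  qed
  then show False using s0 degs by (metis leading_coeff_0_iff)
qed

text \<open>
  For a root \<open>z\<close> of the annihilating polynomial \<open>p\<close>, the eigenvector is \<open>(p / (T - z))(R) R u\<close>.
  Cyclicity of \<open>R u\<close> makes it nonzero and its eigenspace one-dimensional.
\<close>

lemma eigenbasis:
  obtains W v where "finite W" "card W = k" "\<And>z. z \<in> W \<Longrightarrow> v z \<in> V" "lin_indep W v"
    "\<And>z. z \<in> W \<Longrightarrow> R (v z) = z *s v z"
    "\<And>z x. z \<in> W \<Longrightarrow> R x = z *s x \<Longrightarrow> \<exists>c. x = c *s v z"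
proof -
  obtain p where deg: "degree p = k" and p: "\<And>x. act R p (R x) = 0"
    using annihilating_poly by blast
  note nd = no_double_root[OF deg p]
  have p0: "p \<noteq> 0" using deg k_pos by auto
  define W where "W = {z. poly p z = 0}"
  have fin: "finite W" unfolding W_def using p0 by (rule poly_roots_finite)
  have card: "card W = k" unfolding W_def using card_roots_eq_degree[OF p0 nd] deg by simp
  define c where "c z = p div [:-z, 1:]" for z
  have c: "p = [:-z, 1:] * c z" if "z \<in> W" for z
    using that by (simp only: c_def W_def mem_Collect_eq poly_eq_0_iff_dvd dvd_mult_div_cancel)
  have c0: "c z \<noteq> 0" if "z \<in> W" for z using c[OF that] p0 by auto
  have degc: "degree (c z) < k" if "z \<in> W" for z
  proof -
    have "degree p = degree [:-z, 1:] + degree (c z)"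
      using c[OF that] c0[OF that] by (metis degree_mult_eq pCons_eq_0_iff one_neq_zero)
    then show ?thesis using deg by simp
  qed
  have cz: "poly (c z) y \<noteq> 0 \<longleftrightarrow> y = z" if "z \<in> W" "y \<in> W" for y z
  proof -
    have "poly p y = (y - z) * poly (c z) y"
      by (subst c[OF that(1)]) (simp add: algebra_simps)
    moreover have "poly p y = 0" using that(2) by (simp add: W_def)
    moreover have "poly (c z) z \<noteq> 0"
    proof
      assume "poly (c z) z = 0"
      then obtain g where "c z = [:-z, 1:] * g" unfolding poly_eq_0_iff_dvd by (rule dvdE)
      then show False using nd[of z g] c[OF that(1)] by simp
    qed
    ultimately show ?thesis by auto
  qed
  have z0: "z \<noteq> 0" if "z \<in> W" for z
  proof
    assume "z = 0"
    then have "act R (c z) (R (R u)) = act R p (R u)"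
      using c[OF that] by (subst c[OF that]) (simp add: act_mult[OF linR] act_pCons[OF linR] act_0 act_self[OF linR] R_simps)
    then show False using act_inj2[OF degc[OF that]] c0[OF that] p by simp
  qed
  define v where "v z = act R (c z) (R u)" for z
  have vV: "v z \<in> V" for z
    unfolding v_def act_self[OF linR] by (rule R_in_V)
  have Rv: "R (v z) = z *s v z" if "z \<in> W" for z
  proof -
    have "act R [:-z, 1:] (v z) = 0"
      unfolding v_def using p[of u] c[OF that] act_mult[OF linR] by metis
    then show ?thesis by (simp add: act_pCons[OF linR] act_0 R_simps)
  qed
  have v0: "v z \<noteq> 0" if "z \<in> W" for z
    unfolding v_def using act_inj degc c0 that by blast
  \<comment> \<open>The operator \<open>(p / (T - z))(R)\<close> kills every eigenvector but that of
    \<open>z\<close>.\<close>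
  have ind: "lin_indep W v"
    unfolding lin_indep_def
  proof (intro allI impI ballI)
    fix q z assume 0: "(\<Sum>y\<in>W. q y *s v y) = 0" and z: "z \<in> W"
    have "0 = act R (c z) (\<Sum>y\<in>W. q y *s v y)"
      unfolding 0 by (simp add: clin_zero[OF clin_act[OF linR]])
    also have "\<dots> = (\<Sum>y\<in>W. q y *s (poly (c z) y *s v y))"
      using act_eigenvector[OF linR Rv]
      by (simp add: clin_sum[OF clin_act[OF linR]] clin_scale[OF clin_act[OF linR]])
    also have "\<dots> = (\<Sum>y\<in>{z}. q y *s (poly (c z) y *s v y))"
      using fin z cz by (intro sum.mono_neutral_right) auto
    finally show "q z = 0" using v0 cz z by auto
  qed
  have "\<exists>d. x = d *s v z" if z: "z \<in> W" and x: "R x = z *s x" for x z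
  proof -
    have "x = R ((1 / z) *s x)" using z0[OF z] x by (simp add: R_simps)
    then have "x \<in> V" using R_in_V by metis
    then obtain q where q: "degree q < k" "x = act R q (R u)" by (rule V_cyclic)
    \<comment> \<open>Writing \<open>x = q(R) R u\<close>, the polynomial \<open>(T - z) q\<close> annihilates \<open>R
      u\<close>, hence is a multiple of \<open>p\<close>.\<close>
    let ?l = "[:-z, 1:]"
    define d where "d = coeff (?l * q) k / lead_coeff p"
    define r where "r = ?l * q + Polynomial.smult (- d) p"
    have "act R r (R u) = 0"
      unfolding r_def act_add act_smult p act_mult[OF linR] q(2)[symmetric]
      using x by (simp add: act_pCons[OF linR] act_0 R_simps)
    moreover have "degree r < k"
    proof (rule degree_lessI)
      have lq: "degree (?l * q) \<le> k" using q(1) degree_mult_le[of ?l q] by simp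
      have co: "coeff r i = coeff (?l * q) i - d * coeff p i" for i
        by (simp only: r_def coeff_add coeff_smult) simp
      show "\<forall>i\<ge>k. coeff r i = 0"
      proof (intro allI impI)
        fix i assume "k \<le> i"
        then consider "i = k" | "k < i" by linarith
        then show "coeff r i = 0"
        proof cases
          case 1
          moreover have "coeff p k \<noteq> 0" using deg p0 leading_coeff_0_iff by metis
          ultimately show ?thesis unfolding co d_def deg by (simp only: nonzero_eq_divide_eq) simp
        next
          case 2
          then have "coeff (?l * q) i = 0" "coeff p i = 0"
            using lq deg by (intro coeff_eq_0, linarith)+
          then show ?thesis unfolding co by (simp only: mult_zero_right diff_zero)
        qed
      qed
    qed (use k_pos in simp)
    ultimately have "r = 0" by (rule_tac act_inj)
    then have "?l * q = ?l * Polynomial.smult d (c z)"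
      using c[OF z] by (simp add: r_def add_eq_0_iff)
    then have "q = Polynomial.smult d (c z)"
      by (metis mult_cancel_left pCons_eq_0_iff one_neq_zero)
    then show ?thesis using q(2) by (auto simp: act_smult v_def)
  qed
  with that[of W v] fin card vV ind Rv show thesis by blast
qed

text \<open>
  The image of \<open>R\<close> lies in \<open>V\<close>, so all \<open>\<tau>_j m\<close> vanish and \<open>m\<close> lies in \<open>V\<close> as well.
\<close>

lemma N_kills_V_imp_0:
  assumes "m \<in> N" "\<And>x. x \<in> V \<Longrightarrow> lam x m = 0"
  shows "m = 0"
proof (rule V_Int_N)
  have "lam ((R ^^ Suc j) x) m = 0" for j x
    using assms(2) R_in_V by simp
  then show "m \<in> V" by (simp only: V_def \<tau>_def ctr_zero mem_Collect_eq) simp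
qed (rule assms(1))

lemma N_mult: "m \<in> N \<Longrightarrow> m' \<in> N \<Longrightarrow> lam m m' \<in> N"
  by (simp add: N_def R_deriv lam_simps)

text \<open>
  Both \<open>lam (v z) m\<close> and \<open>lam m (v z)\<close> with \<open>m\<close> in \<open>N\<close> are again eigenvectors of the derivation
  \<open>R\<close> for \<open>z\<close>, hence multiples of \<open>v z\<close>.  Everything else is extracted from the Leibniz
  identity.
\<close>

lemma splitting:
  obtains W :: "complex set" and v n :: "complex \<Rightarrow> complex^'n" and S where
    "finite W" "card W = k" "S \<subseteq> W"
    "\<And>q r. (\<Sum>z\<in>W. q z *s v z) + (\<Sum>z\<in>W. r z *s n z) = 0
        \<Longrightarrow> (\<forall>z\<in>W. q z = 0) \<and> (\<forall>z\<in>W. r z = 0)"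
    "\<And>y z. y \<in> W \<Longrightarrow> z \<in> W \<Longrightarrow> lam (v y) (n z) = (if y = z then v y else 0)"
    "\<And>y z. y \<in> W \<Longrightarrow> z \<in> W \<Longrightarrow> lam (n z) (v y) = (if y = z \<and> y \<in> S then - v y else 0)"
    "\<And>y z. y \<in> W \<Longrightarrow> z \<in> W \<Longrightarrow> lam (v y) (v z) = 0"
    "\<And>y z. y \<in> W \<Longrightarrow> z \<in> W \<Longrightarrow> lam (n y) (n z) = 0"
proof -
  obtain W v where fin: "finite W" and card: "card W = k"
    and vV: "\<And>z. z \<in> W \<Longrightarrow> v z \<in> V" and ind: "lin_indep W v"
    and Rv: "\<And>z. z \<in> W \<Longrightarrow> R (v z) = z *s v z"
    and simple: "\<And>z x. z \<in> W \<Longrightarrow> R x = z *s x \<Longrightarrow> \<exists>c. x = c *s v z"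
    using eigenbasis by blast
  have comb_V: "(\<Sum>z\<in>W. q z *s v z) \<in> V" for q
    by (intro V_sum V_scale vV)
  have right: "\<exists>c. lam (v z) m = c *s v z" and left: "\<exists>c. lam m (v z) = c *s v z"
    if "z \<in> W" "m \<in> N" for z m
    using that by (auto intro!: simple simp: R_deriv Rv N_def lam_simps)
  have v0: "v z \<noteq> 0" if "z \<in> W" for z
  proof
    assume "v z = 0"
    then have "(\<Sum>y\<in>W. (if y = z then 1 else 0) *s v y) = 0"
      by (intro sum.neutral) auto
    from lin_indepD[OF ind this that] show False by simp
  qed
  have NV_0: "m = 0" if m: "m \<in> N" and vm: "\<And>z. z \<in> W \<Longrightarrow> lam (v z) m = 0" for m
  proof (rule N_kills_V_imp_0[OF m])
    fix x assume "x \<in> V"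
    then obtain q where "x = (\<Sum>z\<in>W. q z *s v z)"
      using V_spanned[OF fin card vV ind] by blast
    then show "lam x m = 0" using vm by (simp add: lam_simps)
  qed
  \<comment> \<open>The map \<open>m \<mapsto> lam s m\<close> from \<open>N\<close> to \<open>V\<close> collects all right
    eigenvalues of \<open>m\<close>; its bijectivity gives the dual elements.\<close>
  define s where "s = (\<Sum>z\<in>W. v z)"
  have s_coeff: "lam (v z) m = q z *s v z"
    if m: "m \<in> N" and s: "lam s m = (\<Sum>z\<in>W. q z *s v z)" and z: "z \<in> W" for m q z
  proof -
    obtain c where c: "\<And>z. z \<in> W \<Longrightarrow> lam (v z) m = c z *s v z"
      using right[OF _ m] by metis
    have "(\<Sum>z\<in>W. (c z - q z) *s v z) = lam s m - (\<Sum>z\<in>W. q z *s v z)"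
      unfolding s_def using c by (simp add: lam_simps vec.scale_left_diff_distrib sum_subtractf)
    then have "c z - q z = 0" using s z by (intro lin_indepD[OF ind]) auto
    then show ?thesis using c[OF z] by simp
  qed
  \<comment> \<open>The \<open>N\<close>-components of the \<open>h_l\<close> supply the \<open>k\<close> independent
    elements needed for surjectivity.\<close>
  have "\<exists>x m. x \<in> V \<and> m \<in> N \<and> h l = x + m" for l
    by (rule V_plus_N[of "h l"]) blast
  then obtain h1 h2 where h: "\<And>l. h1 l \<in> V" "\<And>l. h2 l \<in> N" "\<And>l. h l = h1 l + h2 l"
    by metis
  have indN: "lin_indep {..<k} (\<lambda>l. lam s (h2 l))"
    unfolding lin_indep_def
  proof (intro allI impI)
    fix r assume 0: "(\<Sum>l<k. r l *s lam s (h2 l)) = 0"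
    define m where "m = (\<Sum>l<k. r l *s h2 l)"
    have mN: "m \<in> N" unfolding m_def by (intro N_sum N_scale h)
    have "lam s m = (\<Sum>z\<in>W. 0 *s v z)"
      using 0 by (simp add: m_def lam_simps)
    then have "lam (v z) m = 0" if "z \<in> W" for z
      using s_coeff[OF mN _ that, of "\<lambda>z. 0"] by (simp only: vec.scale_zero_left)
    then have "m = 0" by (rule NV_0[OF mN])
    then have "(\<Sum>l<k. r l *s h l) = (\<Sum>l<k. r l *s h1 l)"
      by (simp add: h(3) m_def vec.scale_right_distrib sum.distrib)
    moreover have "\<dots> \<in> V" by (intro V_sum V_scale h)
    ultimately show "\<forall>l\<in>{..<k}. r l = 0" using comb_h_in_V by simp
  qed
  have sV: "lam s m \<in> V" if m: "m \<in> N" for m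
  proof -
    obtain c where "\<And>z. z \<in> W \<Longrightarrow> lam (v z) m = c z *s v z"
      using right[OF _ m] by metis
    then have "lam s m = (\<Sum>z\<in>W. c z *s v z)"
      unfolding s_def by (simp add: lam_simps)
    then show ?thesis using comb_V by simp
  qed
  have "\<exists>m\<in>N. lam s m = v z" if "z \<in> W" for z
  proof -
    have vz: "v z \<in> V" using that by (rule vV)
    obtain r where "v z = (\<Sum>l<k. r l *s lam s (h2 l))"
      using V_spanned[OF _ _ _ indN vz] sV h(2) by auto
    then have "v z = lam s (\<Sum>l<k. r l *s h2 l)" by (simp add: lam_simps)
    moreover have "(\<Sum>l<k. r l *s h2 l) \<in> N" by (intro N_sum N_scale h)
    ultimately show ?thesis by metis
  qed
  then obtain n where nN: "\<And>z. z \<in> W \<Longrightarrow> n z \<in> N" and sn: "\<And>z. z \<in> W \<Longrightarrow> lam s (n z) = v z"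
    by metis
  have vn: "lam (v y) (n z) = (if y = z then v y else 0)" if y: "y \<in> W" and z: "z \<in> W" for y z
  proof -
    have "(\<Sum>x\<in>W. (if x = z then 1 else 0) *s v x) = (\<Sum>x\<in>W. if x = z then v x else 0)"
      by (intro sum.cong) auto
    also have "\<dots> = v z" using fin z by simp
    finally have "lam s (n z) = (\<Sum>x\<in>W. (if x = z then 1 else 0) *s v x)"
      using sn[OF z] by simp
    from s_coeff[OF nN[OF z] this y] show ?thesis by simp
  qed
  have NN: "lam m m' = 0" if m: "m \<in> N" "m' \<in> N" for m m'
  proof (rule NV_0[OF N_mult[OF m]])
    fix z assume z: "z \<in> W"
    obtain c c' where "lam (v z) m = c *s v z" "lam (v z) m' = c' *s v z"
      using right[OF z m(1)] right[OF z m(2)] by blast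
    then show "lam (v z) (lam m m') = 0"
      unfolding leib[of "v z" m m'] by (simp add: lam_simps mult.commute)
  qed
  \<comment> \<open>The sum of the dual elements acts on \<open>V\<close> from the right as the identity, so products of two
    elements of \<open>V\<close> are multiplied by \<open>2\<close>. But \<open>V\<close> is the whole image of this action,
    so that such a product lies in \<open>V\<close> and is also fixed.\<close>
  define w where "w = (\<Sum>z\<in>W. n z)"
  have wN: "w \<in> N" unfolding w_def by (intro N_sum nN)
  have w1: "lam x w = x" if "x \<in> V" for x
  proof -
    obtain q where q: "x = (\<Sum>z\<in>W. q z *s v z)"
      using V_spanned[OF fin card vV ind \<open>x \<in> V\<close>] by blast
    have "lam (v z) w = v z" if "z \<in> W" for z
      unfolding w_def using fin that vn by (simp add: lam_simps)
    then show ?thesis unfolding q by (simp add: lam_simps)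
  qed
  have VV: "lam x y = 0" if "x \<in> V" "y \<in> V" for x y
  proof -
    let ?z = "lam x y"
    have two: "lam ?z w = ?z + ?z"
      using leib[of x y w] w1[OF that(1)] w1[OF that(2)] by (simp add: algebra_simps)
    obtain z' m where z': "z' \<in> V" "m \<in> N" "?z = z' + m" using V_plus_N .
    have "lam ?z w = z'"
      using w1[OF z'(1)] NN[OF z'(2) wN] unfolding z'(3) by (simp add: lam_simps)
    then have eq: "?z + ?z = z'" using two by metis
    have "(1 / 2) *s (?z + ?z) = (1 / 2 + 1 / 2) *s ?z"
      by (simp only: vec.scale_right_distrib vec.scale_left_distrib)
    then have "?z = (1 / 2) *s z'" unfolding eq by simp
    then have "?z \<in> V" using V_scale[OF z'(1)] by simp
    then have "?z + ?z = ?z" using w1 two by metis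
    then show ?thesis by (simp only: add_cancel_left_left)
  qed
  define S where "S = {z \<in> W. \<exists>m\<in>N. lam m (v z) \<noteq> 0}"
  have S: "lam m (v z) = - lam (v z) m" if z: "z \<in> S" and m: "m \<in> N" for z m
  proof -
    from z obtain m0 where zW: "z \<in> W" and m0: "m0 \<in> N" "lam m0 (v z) \<noteq> 0"
      unfolding S_def by blast
    obtain c where c: "lam m0 (v z) = c *s v z" using left[OF zW m0(1)] by blast
    obtain d where d: "lam m (v z) = d *s v z" using left[OF zW m] by blast
    obtain e where e: "lam (v z) m = e *s v z" using right[OF zW m] by blast
    \<comment> \<open>With left and right eigenvalues \<open>\<psi>\<close> and \<open>\<phi>\<close> at \<open>v z\<close>
      this says \<open>\<psi>(m) \<psi>(m0) = - \<phi>(m) \<psi>(m0)\<close>.\<close>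
    have "lam m0 (lam m (v z)) = - lam (lam m0 (v z)) m"
      using leib[of m0 m "v z"] NN[OF m0(1) m] by (simp add: lam_simps)
    then have "(d * c) *s v z = (- (c * e)) *s v z"
      by (simp add: c d e lam_simps)
    then have "d * c = - (c * e)" using v0[OF zW] by (metis vec.scale_cancel_right)
    then have "(d + e) * c = 0" by (simp add: distrib_right)
    then have "d + e = 0" using c m0(2) by auto
    then have "d = - e" by (simp only: eq_neg_iff_add_eq_0)
    then show ?thesis by (simp add: d e)
  qed
  have nv: "lam (n z) (v y) = (if y = z \<and> y \<in> S then - v y else 0)"
    if y: "y \<in> W" and z: "z \<in> W" for y z
  proof (cases "y \<in> S")
    case True
    then show ?thesis using S[OF True nN[OF z]] vn[OF y z] by simp
  next
    case False
    then show ?thesis using y nN[OF z] by (simp add: S_def)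
  qed
  have joint: "(\<forall>z\<in>W. q z = 0) \<and> (\<forall>z\<in>W. r z = 0)"
    if 0: "(\<Sum>z\<in>W. q z *s v z) + (\<Sum>z\<in>W. r z *s n z) = 0" for q r
  proof -
    have NW: "(\<Sum>z\<in>W. r z *s n z) \<in> N" by (intro N_sum N_scale nN)
    have "(\<Sum>z\<in>W. r z *s n z) = 0 - (\<Sum>z\<in>W. q z *s v z)"
      using 0 by (simp add: add_eq_0_iff)
    then have "(\<Sum>z\<in>W. r z *s n z) \<in> V" using V_diff[OF V_zero comb_V] by simp
    then have r0: "(\<Sum>z\<in>W. r z *s n z) = 0" using NW by (rule V_Int_N)
    have "r y = 0" if y: "y \<in> W" for y
    proof -
      have "0 = lam (v y) (\<Sum>z\<in>W. r z *s n z)" by (simp add: r0 lam_simps)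
      also have "\<dots> = (\<Sum>z\<in>W. if z = y then r y *s v y else 0)"
        using vn[OF y] by (auto simp: lam_simps intro!: sum.cong)
      also have "\<dots> = r y *s v y" using fin y by simp
      finally show ?thesis using v0[OF y] by simp
    qed
    moreover have "(\<Sum>z\<in>W. q z *s v z) = 0" using 0 r0 by simp
    ultimately show ?thesis using lin_indepD[OF ind] by blast
  qed
  show thesis
  proof (rule that[OF fin card _ joint vn nv])
    show "S \<subseteq> W" by (auto simp: S_def)
    show "lam (v y) (v z) = 0" if "y \<in> W" "z \<in> W" for y z using VV vV that by blast
    show "lam (n y) (n z) = 0" if "y \<in> W" "z \<in> W" for y z using NN nN that by blast
  qed
qed

end

section \<open>The algebras with a split multiplication table\<close>

text \<open>
  The products of a basis with the table of some \<open>L_s\<close>, where \<open>T\<close> marks the indices with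
  nonzero left action, determine all products.  It is used both for eigenvectors indexed by
  eigenvalues and for their enumeration.
\<close>

lemma split_table_product:
  assumes lam: "lam \<in> cbilinear_maps" and fin: "finite I"
    and vn: "\<And>i j. i \<in> I \<Longrightarrow> j \<in> I \<Longrightarrow> lam (v i) (n j) = (if i = j then v i else 0)"
    and nv: "\<And>i j. i \<in> I \<Longrightarrow> j \<in> I \<Longrightarrow> lam (n j) (v i) = (if i = j \<and> i \<in> T then - v i else 0)"
    and vv: "\<And>i j. i \<in> I \<Longrightarrow> j \<in> I \<Longrightarrow> lam (v i) (v j) = 0"
    and nn: "\<And>i j. i \<in> I \<Longrightarrow> j \<in> I \<Longrightarrow> lam (n i) (n j) = 0"
  shows "lam ((\<Sum>i\<in>I. q i *s v i) + (\<Sum>i\<in>I. r i *s n i)) ((\<Sum>i\<in>I. q' i *s v i) + (\<Sum>i\<in>I. r' i *s n i))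
    = (\<Sum>i\<in>I. (q i * r' i - (if i \<in> T then r i * q' i else 0)) *s v i)"
proof -
  have right: "lam (v i) ((\<Sum>i\<in>I. q' i *s v i) + (\<Sum>i\<in>I. r' i *s n i)) = r' i *s v i" if "i \<in> I" for i
  proof -
    have "(\<Sum>j\<in>I. r' j *s lam (v i) (n j)) = (\<Sum>j\<in>I. if j = i then r' i *s v i else 0)"
      using that vn by (intro sum.cong) auto
    then show ?thesis
      using that fin vv by (simp add: clin_add[OF cbil_right[OF lam]] clin_sum[OF cbil_right[OF lam]]
          clin_scale[OF cbil_right[OF lam]])
  qed
  have left: "lam (n i) ((\<Sum>i\<in>I. q' i *s v i) + (\<Sum>i\<in>I. r' i *s n i))
      = (if i \<in> T then - (q' i *s v i) else 0)" if "i \<in> I" for i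
  proof -
    have "(\<Sum>j\<in>I. q' j *s lam (n i) (v j))
        = (\<Sum>j\<in>I. if j = i then (if i \<in> T then - (q' i *s v i) else 0) else 0)"
      using that nv by (intro sum.cong) auto
    then show ?thesis
      using that fin nn by (simp add: clin_add[OF cbil_right[OF lam]] clin_sum[OF cbil_right[OF lam]]
          clin_scale[OF cbil_right[OF lam]])
  qed
  have "lam ((\<Sum>i\<in>I. q i *s v i) + (\<Sum>i\<in>I. r i *s n i)) ((\<Sum>i\<in>I. q' i *s v i) + (\<Sum>i\<in>I. r' i *s n i))
    = (\<Sum>i\<in>I. q i *s (r' i *s v i)) + (\<Sum>i\<in>I. r i *s (if i \<in> T then - (q' i *s v i) else 0))"
    using right left by (simp add: clin_add[OF cbil_left[OF lam]] clin_sum[OF cbil_left[OF lam]]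
        clin_scale[OF cbil_left[OF lam]])
  also have "\<dots> = (\<Sum>i\<in>I. (q i * r' i - (if i \<in> T then r i * q' i else 0)) *s v i)"
    unfolding sum.distrib[symmetric]
    by (intro sum.cong) (auto simp: vec.scale_left_diff_distrib)
  finally show ?thesis .
qed

lemma vandermonde_kernel:
  assumes "\<And>l. l < k \<Longrightarrow> (\<Sum>j<k. q j * of_nat (Suc l) ^ (j + d)) = (0::complex)"
  shows "\<forall>j<k. q j = 0"
proof (cases "k = 0")
  case False
  then obtain p where p: "degree p < k" "\<And>i. i < k \<Longrightarrow> coeff p i = q i"
    using exists_poly_with_coeffs[of k q] by auto
  have roots: "(\<lambda>l. of_nat (Suc l)) ` {..<k} \<subseteq> {x. poly p x = 0}"
  proof clarify
    fix l assume l: "l < k"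
    have "poly p (of_nat (Suc l)) = (\<Sum>j\<le>degree p. coeff p j * of_nat (Suc l) ^ j)"
      by (simp add: poly_altdef)
    also have "\<dots> = (\<Sum>j<k. coeff p j * of_nat (Suc l) ^ j)"
      using p(1) by (intro sum.mono_neutral_left) (auto simp: coeff_eq_0)
    also have "\<dots> = (\<Sum>j<k. q j * of_nat (Suc l) ^ j)"
      using p(2) by simp
    also have "\<dots> * of_nat (Suc l) ^ d = (\<Sum>j<k. q j * of_nat (Suc l) ^ (j + d))"
      by (simp add: sum_distrib_right power_add mult.assoc)
    ultimately have "poly p (of_nat (Suc l)) * of_nat (Suc l) ^ d = 0"
      using assms[OF l] by simp
    moreover have "of_nat (Suc l) \<noteq> (0::complex)" by (simp only: of_nat_eq_0_iff)
    ultimately show "poly p (of_nat (Suc l)) = 0" by simp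
  qed
  have "p = 0"
  proof (rule ccontr)
    assume "p \<noteq> 0"
    then have "card ((\<lambda>l. of_nat (Suc l) :: complex) ` {..<k}) \<le> degree p"
      using roots card_mono[OF poly_roots_finite[of p]] card_poly_roots_bound[of p] by (meson le_trans)
    moreover have "card ((\<lambda>l. of_nat (Suc l) :: complex) ` {..<k}) = k"
      by (subst card_image) (auto simp: inj_on_def simp del: of_nat_Suc)
    ultimately show False using p(1) by simp
  qed
  then show ?thesis using p(2) by auto
qed simp

lemma polyfun_funpow:
  fixes x :: "(complex^'n \<Rightarrow> complex^'n \<Rightarrow> complex^'n) \<Rightarrow> complex^'n"
  assumes "\<And>i. polyfun (\<lambda>lam. x lam $ i)"
  shows "polyfun (\<lambda>lam. ((\<lambda>y. lam y a) ^^ j) (x lam) $ i)"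
  by (induction j arbitrary: i) (auto intro: assms polyfun_apply polyfun_const)

text \<open>
  The algebra \<open>L_t\<close> with its basis split into two families indexed by \<open>l < k\<close>: the vectors
  \<open>e_i\<close> followed by the \<open>f_j\<close>, and the \<open>x_i\<close> followed by the \<open>y_j\<close>.  The parameters
  \<open>ix_e\<close> and \<open>ix_h\<close> give their coordinate positions.
\<close>

locale split_model =
  fixes ix_e ix_h :: "nat \<Rightarrow> 'n::finite" and k t :: nat
  assumes inj_e: "inj_on ix_e {..<k}" and inj_h: "inj_on ix_h {..<k}"
    and disj: "\<And>l l'. l < k \<Longrightarrow> l' < k \<Longrightarrow> ix_e l \<noteq> ix_h l'"
    and cover: "UNIV = ix_e ` {..<k} \<union> ix_h ` {..<k}"
    and t_le: "t \<le> k"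
begin

definition "ee l = (axis (ix_e l) 1 :: complex^'n)"
definition "hh l = (axis (ix_h l) 1 :: complex^'n)"

definition model :: "complex^'n \<Rightarrow> complex^'n \<Rightarrow> complex^'n" where
  "model x y = (\<Sum>l<k. (x $ ix_e l * y $ ix_h l
      - (if l \<in> {t..<k} then x $ ix_h l * y $ ix_e l else 0)) *s ee l)"

text \<open>
  Any coefficients that are distinct and nonzero would do in \<open>gen\<close>: on the algebra itself they are
  the nonzero eigenvalues of right multiplication by \<open>gen\<close>.
\<close>

definition "gen = (\<Sum>l<k. of_nat (Suc l) *s hh l)"
definition "cyc = (\<Sum>l<k. ee l)"

definition right_pow :: "(complex^'n \<Rightarrow> complex^'n \<Rightarrow> complex^'n) \<Rightarrow> nat \<Rightarrow> complex^'n \<Rightarrow> complex^'n"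
  where "right_pow lam j = (\<lambda>x. lam x gen) ^^ j"

text \<open>
  In an algebra with a split table the first summand keeps only the eigenvectors with nonzero left
  action, while the sum of both keeps only the others.
\<close>

definition test_vec :: "(complex^'n \<Rightarrow> complex^'n \<Rightarrow> complex^'n) \<Rightarrow> nat \<Rightarrow> complex^'n" where
  "test_vec lam l = lam gen (lam (ee l) gen)
  + (if l < t then lam (lam (ee l) gen) gen else 0)"

definition "D_cyc lam = Determinant.det (Matrix.mat k k (\<lambda>(j, l). right_pow lam (j + 2) cyc $ ix_e l))"
definition "D_trace lam = Determinant.det (Matrix.mat k k (\<lambda>(j, l). ctr (\<lambda>x. lam (right_pow lam (Suc j) x) (hh l))))"
definition "D_type lam = Determinant.det (Matrix.mat k k (\<lambda>(l, l'). test_vec lam l $ ix_e l'))"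

lemma coord_ee: "l < k \<Longrightarrow> l' < k \<Longrightarrow> ee l $ ix_e l' = (if l = l' then 1 else 0)"
  "l < k \<Longrightarrow> l' < k \<Longrightarrow> ee l $ ix_h l' = 0"
  using inj_e disj not_sym[OF disj] by (auto simp: ee_def axis_def inj_on_def)

lemma coord_hh: "l < k \<Longrightarrow> l' < k \<Longrightarrow> hh l $ ix_h l' = (if l = l' then 1 else 0)"
  "l < k \<Longrightarrow> l' < k \<Longrightarrow> hh l $ ix_e l' = 0"
  using inj_h disj not_sym[OF disj] by (auto simp: hh_def axis_def inj_on_def)

lemma coord_sum_ee:
  assumes "l < k"
  shows "(\<Sum>i<k. c i *s ee i) $ ix_e l = c l" "(\<Sum>i<k. c i *s ee i) $ ix_h l = 0"
proof -
  have "(\<Sum>i<k. c i *s ee i) $ ix_e l = (\<Sum>i<k. if i = l then c l else 0)"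
    unfolding sum_component using assms by (intro sum.cong) (auto simp: coord_ee)
  then show "(\<Sum>i<k. c i *s ee i) $ ix_e l = c l" using assms by simp
  show "(\<Sum>i<k. c i *s ee i) $ ix_h l = 0"
    unfolding sum_component using assms by (intro sum.neutral) (auto simp: coord_ee)
qed

lemma coord_sum_hh:
  assumes "l < k"
  shows "(\<Sum>i<k. c i *s hh i) $ ix_h l = c l" "(\<Sum>i<k. c i *s hh i) $ ix_e l = 0"
proof -
  have "(\<Sum>i<k. c i *s hh i) $ ix_h l = (\<Sum>i<k. if i = l then c l else 0)"
    unfolding sum_component using assms by (intro sum.cong) (auto simp: coord_hh)
  then show "(\<Sum>i<k. c i *s hh i) $ ix_h l = c l" using assms by simp
  show "(\<Sum>i<k. c i *s hh i) $ ix_e l = 0"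
    unfolding sum_component using assms by (intro sum.neutral) (auto simp: coord_hh)
qed

lemma vec_eqI:
  assumes "\<And>l. l < k \<Longrightarrow> x $ ix_e l = y $ ix_e l" "\<And>l. l < k \<Longrightarrow> x $ ix_h l = y $ ix_h l"
  shows "x = y"
  unfolding Finite_Cartesian_Product.vec_eq_iff
proof
  fix i
  have "i \<in> ix_e ` {..<k} \<union> ix_h ` {..<k}" unfolding cover[symmetric] by simp
  then show "x $ i = y $ i" using assms by auto
qed

lemma sum_UNIV: "(\<Sum>i\<in>UNIV. f i) = (\<Sum>l<k. f (ix_e l)) + (\<Sum>l<k. f (ix_h l))"
proof -
  have "(\<Sum>i\<in>UNIV. f i) = (\<Sum>i\<in>ix_e ` {..<k}. f i) + (\<Sum>i\<in>ix_h ` {..<k}. f i)"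
    unfolding cover using disj by (intro sum.union_disjoint) auto
  then show ?thesis by (simp add: sum.reindex inj_e inj_h)
qed

lemma card_UNIV: "CARD('n) = 2 * k"
  using sum_UNIV[of "\<lambda>_. 1::nat"] by simp

lemma coord_model:
  assumes "l < k"
  shows "model x y $ ix_e l = x $ ix_e l * y $ ix_h l - (if t \<le> l then x $ ix_h l * y $ ix_e l else 0)"
    "model x y $ ix_h l = 0"
  unfolding model_def using assms by (simp_all only: coord_sum_ee) simp

lemma model_cbil: "model \<in> cbilinear_maps"
  unfolding cbilinear_maps_def
  by (auto intro!: clinI vec_eqI simp: coord_model algebra_simps)

lemma model_Leib: "model \<in> Leib"
  unfolding Leib_def using model_cbil
  by (auto intro!: vec_eqI simp: coord_model algebra_simps)

lemma coord_gen: "l < k \<Longrightarrow> gen $ ix_h l = of_nat (Suc l)" "l < k \<Longrightarrow> gen $ ix_e l = 0"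
  unfolding gen_def by (simp_all only: coord_sum_hh)

lemma coord_cyc: "l < k \<Longrightarrow> cyc $ ix_e l = 1" "l < k \<Longrightarrow> cyc $ ix_h l = 0"
  unfolding cyc_def using coord_sum_ee[of l "\<lambda>_. 1"] by simp_all

lemma coord_right_pow_model:
  assumes "l < k"
  shows "right_pow model j x $ ix_e l = of_nat (Suc l) ^ j * x $ ix_e l"
  unfolding right_pow_def
  by (induction j) (simp_all add: coord_model coord_gen assms algebra_simps del: of_nat_Suc)

lemma D_cyc_model: "D_cyc model \<noteq> 0"
  unfolding D_cyc_def det_nonzero_iff_rows
proof (intro allI impI)
  fix q i assume 0: "\<forall>l<k. (\<Sum>j<k. q j * right_pow model (j + 2) cyc $ ix_e l) = 0"
    and "i < k"
  have "(\<Sum>j<k. q j * of_nat (Suc l) ^ (j + 2)) = 0" if "l < k" for l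
    using 0[rule_format, OF that]
    by (simp only: coord_right_pow_model[OF that] coord_cyc(1)[OF that] mult_1_right)
  then show "q i = 0" using vandermonde_kernel[of k q 2] \<open>i < k\<close> by blast
qed

lemma trace_model:
  assumes "l < k"
  shows "ctr (\<lambda>x. model (right_pow model (Suc j) x) (hh l)) = of_nat (Suc l) ^ Suc j"
proof -
  have "ctr (\<lambda>x. model (right_pow model (Suc j) x) (hh l))
      = (\<Sum>l'<k. model (right_pow model (Suc j) (ee l')) (hh l) $ ix_e l')"
    unfolding ctr_def sum_UNIV ee_def by (simp add: coord_model)
  also have "\<dots> = (\<Sum>l'<k. if l' = l then of_nat (Suc l) ^ Suc j else 0)"
    using assms
    by (intro sum.cong) (auto simp: coord_model coord_right_pow_model coord_ee coord_hh
        simp del: of_nat_Suc power_Suc)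
  also have "\<dots> = of_nat (Suc l) ^ Suc j" using assms by simp
  finally show ?thesis .
qed

lemma D_trace_model: "D_trace model \<noteq> 0"
  unfolding D_trace_def det_nonzero_iff_rows
proof (intro allI impI)
  fix q i assume 0: "\<forall>l<k. (\<Sum>j<k. q j * ctr (\<lambda>x. model (right_pow model (Suc j) x) (hh l))) = 0"
    and "i < k"
  have "(\<Sum>j<k. q j * of_nat (Suc l) ^ (j + 1)) = 0" if "l < k" for l
    using 0[rule_format, OF that] by (simp only: trace_model[OF that]) (simp only: Suc_eq_plus1)
  then show "q i = 0" using vandermonde_kernel[of k q 1] \<open>i < k\<close> by blast
qed

lemma test_vec_model:
  assumes "l < k" "l' < k"
  shows "test_vec model l $ ix_e l' = (if l = l' then (if l < t then 1 else - 1) * of_nat (Suc l) ^ 2 else 0)"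
  using assms unfolding test_vec_def
  by (simp add: coord_model coord_gen coord_ee power2_eq_square del: of_nat_Suc)

lemma D_type_model: "D_type model \<noteq> 0"
  unfolding D_type_def det_nonzero_iff_rows
proof (intro allI impI)
  fix q l assume 0: "\<forall>j<k. (\<Sum>i<k. q i * test_vec model i $ ix_e j) = 0" and l: "l < k"
  have "(\<Sum>i<k. q i * test_vec model i $ ix_e l)
      = (\<Sum>i<k. if i = l then q l * ((if l < t then 1 else - 1) * of_nat (Suc l) ^ 2) else 0)"
    using l by (intro sum.cong) (auto simp: test_vec_model simp del: of_nat_Suc)
  also have "\<dots> = q l * ((if l < t then 1 else - 1) * of_nat (Suc l) ^ 2)" using l by simp
  finally have "q l * ((if l < t then 1 else - 1) * of_nat (Suc l) ^ 2) = 0" using 0 l by simp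
  then show "q l = 0" by (simp del: of_nat_Suc add: of_nat_eq_0_iff split: if_splits)
qed

lemma polyfun_D: "polyfun (\<lambda>lam. D_cyc lam * D_trace lam * D_type lam)"
proof (intro polyfun_mult)
  show "polyfun D_cyc"
    unfolding D_cyc_def right_pow_def
    by (intro polyfun_det polyfun_funpow polyfun_const)
  show "polyfun D_trace"
    unfolding D_trace_def right_pow_def ctr_def
    by (intro polyfun_det polyfun_sum polyfun_apply polyfun_funpow polyfun_const)
  show "polyfun D_type"
    unfolding D_type_def
  proof (intro polyfun_det)
    fix l l'
    have 1: "polyfun (\<lambda>lam. lam gen (lam (ee l) gen) $ i)"
      and 2: "polyfun (\<lambda>lam. lam (lam (ee l) gen) gen $ i)" for i
      by (intro polyfun_apply polyfun_const)+
    show "polyfun (\<lambda>lam. test_vec lam l $ ix_e l')"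
      unfolding test_vec_def using polyfun_add[OF 1 2] 1 by (cases "l < t") simp_all
  qed
qed

text \<open>
  The linear map that carries the standard basis to the frame \<open>v, n\<close> is invertible and transports
  the product of the model to \<open>lam\<close>.
\<close>

lemma model_in_frame:
  assumes "lam \<in> cbilinear_maps"
    and ind: "\<And>q r. (\<Sum>l<k. q l *s v l) + (\<Sum>l<k. r l *s n l) = 0
        \<Longrightarrow> (\<forall>l<k. q l = 0) \<and> (\<forall>l<k. r l = 0)"
    and "\<And>i j. i < k \<Longrightarrow> j < k \<Longrightarrow> lam (v i) (n j) = (if i = j then v i else 0)"
    and "\<And>i j. i < k \<Longrightarrow> j < k \<Longrightarrow> lam (n j) (v i) = (if i = j \<and> i \<in> {t..<k} then - v i else 0)"
    and "\<And>i j. i < k \<Longrightarrow> j < k \<Longrightarrow> lam (v i) (v j) = 0"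
    and "\<And>i j. i < k \<Longrightarrow> j < k \<Longrightarrow> lam (n i) (n j) = 0"
  shows "lam \<in> Orb model"
proof -
  define G where "G x = (\<Sum>l<k. x $ ix_e l *s v l) + (\<Sum>l<k. x $ ix_h l *s n l)" for x :: "complex^'n"
  have linG: "clin G"
    unfolding G_def
    by (rule clinI) (simp_all add: vec.scale_left_distrib sum.distrib vec.scale_right_distrib vec.scale_sum_right)
  have G_model: "G (model x y) = lam (G x) (G y)" for x y
  proof -
    have "lam (G x) (G y) = (\<Sum>l<k. (x $ ix_e l * y $ ix_h l
        - (if l \<in> {t..<k} then x $ ix_h l * y $ ix_e l else 0)) *s v l)"
      unfolding G_def by (intro split_table_product) (use assms in auto)
    also have "\<dots> = G (model x y)"
      unfolding G_def by (simp add: coord_model)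
    finally show ?thesis by simp
  qed
  define g where "g = matrix G"
  have g: "g *v x = G x" for x unfolding g_def using linG by (rule matrix_works)
  have "x = 0" if "g *v x = 0" for x
    using ind[of "\<lambda>l. x $ ix_e l" "\<lambda>l. x $ ix_h l"] that unfolding g G_def
    by (intro vec_eqI) auto
  then have "invertible g"
    unfolding invertible_left_inverse matrix_left_invertible_ker by blast
  then have gGL: "g \<in> GL" by (simp add: GL_def)
  have "lam = GL_action g model"
    unfolding GL_action_def g G_model unfolding g[symmetric]
    by (simp add: matrix_vector_mul_assoc GL_inverse[OF gGL])
  then show ?thesis unfolding Orb_def using gGL by blast
qed

text \<open>
  The first two determinants give a split table for \<open>lam\<close>, with the set \<open>S\<close> of indices with nonzero
  left action unknown.  Independence of the test vectors gives \<open>k - t \<le> card S\<close> and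
  \<open>t \<le> k - card S\<close>, hence equality, and the eigenvalues can be enumerated so that \<open>S\<close> occupies the
  positions from \<open>t\<close> on.
\<close>

lemma orbit_of_nonvanishing:
  assumes lam: "lam \<in> Leib" and nz: "D_cyc lam * D_trace lam * D_type lam \<noteq> 0"
  shows "lam \<in> Orb model"
proof -
  have cb: "lam \<in> cbilinear_maps" using lam by (simp add: Leib_def)
  interpret split_leibniz lam gen cyc hh k
  proof
    show "CARD('n) = 2 * k" by (rule card_UNIV)
    show "lin_indep {..<k} (\<lambda>j. ((\<lambda>x. lam x gen) ^^ (j + 2)) cyc)"
      unfolding lin_indep_def
    proof (intro allI impI)
      fix q assume "(\<Sum>j<k. q j *s ((\<lambda>x. lam x gen) ^^ (j + 2)) cyc) = 0"
      then have "(\<Sum>j<k. q j *s right_pow lam (j + 2) cyc) $ i = 0" for i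
        by (simp only: right_pow_def) simp
      then have "\<forall>l<k. (\<Sum>j<k. q j * right_pow lam (j + 2) cyc $ ix_e l) = 0"
        by simp
      then show "\<forall>j\<in>{..<k}. q j = 0"
        using nz unfolding D_cyc_def by (simp add: det_nonzero_iff_rows)
    qed
    show "\<forall>j<k. q j = 0" if "\<And>l. l < k \<Longrightarrow>
        (\<Sum>j<k. q j * ctr (\<lambda>x. lam (((\<lambda>x. lam x gen) ^^ Suc j) x) (hh l))) = 0" for q
    proof -
      have "D_trace lam \<noteq> 0" using nz by simp
      then show ?thesis
        using that unfolding D_trace_def det_nonzero_iff_rows right_pow_def by blast
    qed
    show "\<forall>l<k. q l = 0" if "\<And>j. j < k \<Longrightarrow>
        (\<Sum>l<k. q l * ctr (\<lambda>x. lam (((\<lambda>x. lam x gen) ^^ Suc j) x) (hh l))) = 0" for q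
    proof -
      have "D_trace lam \<noteq> 0" using nz by simp
      then show ?thesis
        using that unfolding D_trace_def det_nonzero_iff_cols right_pow_def by blast
    qed
  qed (rule lam)
  obtain W :: "complex set" and v n S where fin: "finite W" and cardW: "card W = k" and SW: "S \<subseteq> W"
    and ind: "\<And>q r. (\<Sum>z\<in>W. q z *s v z) + (\<Sum>z\<in>W. r z *s n z) = 0
        \<Longrightarrow> (\<forall>z\<in>W. q z = 0) \<and> (\<forall>z\<in>W. r z = 0)"
    and vn: "\<And>y z. y \<in> W \<Longrightarrow> z \<in> W \<Longrightarrow> lam (v y) (n z) = (if y = z then v y else 0)"
    and nv: "\<And>y z. y \<in> W \<Longrightarrow> z \<in> W \<Longrightarrow> lam (n z) (v y) = (if y = z \<and> y \<in> S then - v y else 0)"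
    and vv: "\<And>y z. y \<in> W \<Longrightarrow> z \<in> W \<Longrightarrow> lam (v y) (v z) = 0"
    and nn: "\<And>y z. y \<in> W \<Longrightarrow> z \<in> W \<Longrightarrow> lam (n y) (n z) = 0"
  proof (rule splitting, goal_cases)
    case (1 W v n S)
    show ?case by (rule 1(1)) (fact 1)+
  qed
  have product: "lam ((\<Sum>z\<in>W. q z *s v z) + (\<Sum>z\<in>W. r z *s n z))
      ((\<Sum>z\<in>W. q' z *s v z) + (\<Sum>z\<in>W. r' z *s n z))
    = (\<Sum>z\<in>W. (q z * r' z - (if z \<in> S then r z * q' z else 0)) *s v z)" for q r q' r'
    by (rule split_table_product[OF cb fin]) (fact vn nv vv nn)+
  have expand: "\<exists>q r. x = (\<Sum>z\<in>W. q z *s v z) + (\<Sum>z\<in>W. r z *s n z)" for x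
  proof -
    have "card W + card W = CARD('n)" using cardW card_UNIV by simp
    then show ?thesis
      by (rule lin_indep_pair_spans[where w = v and h = n and x = x, OF fin fin])
        (use ind in \<open>blast+\<close>)
  qed
  have type: "lam gen (lam x gen) \<in> vec.span (v ` S)"
    "lam gen (lam x gen) + lam (lam x gen) gen \<in> vec.span (v ` (W - S))" for x
  proof -
    obtain q r where gen: "gen = (\<Sum>z\<in>W. q z *s v z) + (\<Sum>z\<in>W. r z *s n z)"
      using expand by blast
    obtain q' r' where x: "x = (\<Sum>z\<in>W. q' z *s v z) + (\<Sum>z\<in>W. r' z *s n z)"
      using expand by blast
    define p where "p z = q' z * r z - (if z \<in> S then r' z * q z else 0)" for z
    have p: "lam x gen = (\<Sum>z\<in>W. p z *s v z) + (\<Sum>z\<in>W. 0 *s n z)"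
      unfolding gen x product p_def by simp
    have 1: "lam gen (lam x gen) = (\<Sum>z\<in>W. (if z \<in> S then - (r z * p z) else 0) *s v z)"
      unfolding p unfolding gen product by (intro sum.cong) auto
    have 2: "lam (lam x gen) gen = (\<Sum>z\<in>W. (p z * r z) *s v z)"
      unfolding p unfolding gen product by (intro sum.cong) auto
    show "lam gen (lam x gen) \<in> vec.span (v ` S)"
      unfolding 1 by (intro vec.span_sum) (auto intro: vec.span_scale vec.span_base vec.span_neg vec.span_zero)
    show "lam gen (lam x gen) + lam (lam x gen) gen \<in> vec.span (v ` (W - S))"
      unfolding 1 2 sum.distrib[symmetric]
      by (intro vec.span_sum) (auto simp: mult.commute intro: vec.span_scale vec.span_base vec.span_zero)
  qed
  have ind_test: "lin_indep J (test_vec lam)" if J: "J \<subseteq> {..<k}" for J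
    unfolding lin_indep_def
  proof (intro allI impI)
    fix q assume 0: "(\<Sum>i\<in>J. q i *s test_vec lam i) = 0"
    have "(\<Sum>i<k. (if i \<in> J then q i else 0) * test_vec lam i $ j) = 0" for j
    proof -
      have "(\<Sum>i<k. (if i \<in> J then q i else 0) * test_vec lam i $ j)
          = (\<Sum>i\<in>J. (if i \<in> J then q i else 0) * test_vec lam i $ j)"
        using J by (intro sum.mono_neutral_right) auto
      also have "\<dots> = (\<Sum>i\<in>J. q i *s test_vec lam i) $ j" by simp
      finally show ?thesis using 0 by simp
    qed
    moreover have "D_type lam \<noteq> 0" using nz by simp
    ultimately have "\<forall>i<k. (if i \<in> J then q i else 0) = 0"
      unfolding D_type_def det_nonzero_iff_rows
      by (elim allE[where x = "\<lambda>i. if i \<in> J then q i else 0"] impE) blast+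
    then show "\<forall>i\<in>J. q i = 0" using J by (auto split: if_splits)
  qed
  have "card {..<t} \<le> card (W - S)"
    using lin_indep_card_le[of "{..<t}" "test_vec lam" "W - S" v] ind_test[of "{..<t}"] t_le fin type(2)
    by (auto simp: test_vec_def)
  moreover have "{t..<k} \<subseteq> {..<k}" by auto
  then have "card {t..<k} \<le> card S"
    using lin_indep_card_le[of "{t..<k}" "test_vec lam" S v] ind_test[of "{t..<k}"]
      finite_subset[OF SW fin] type(1)
    by (auto simp: test_vec_def)
  moreover have "card (W - S) + card S = k"
    using cardW card_Diff_subset[OF finite_subset[OF SW fin] SW] card_mono[OF fin SW] by simp
  ultimately have cards: "card {..<t} = card (W - S)" "card {t..<k} = card S"
    using t_le by auto
  obtain \<sigma>1 where \<sigma>1: "bij_betw \<sigma>1 {..<t} (W - S)"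
    using finite_same_card_bij[OF _ _ cards(1)] fin by auto
  obtain \<sigma>2 where \<sigma>2: "bij_betw \<sigma>2 {t..<k} S"
    using finite_same_card_bij[OF _ _ cards(2)] finite_subset[OF SW fin] by auto
  define \<sigma> where "\<sigma> l = (if l < t then \<sigma>1 l else \<sigma>2 l)" for l
  have s1: "bij_betw \<sigma> {..<t} (W - S)"
    using \<sigma>1 by (rule bij_betw_cong[THEN iffD1, rotated]) (simp add: \<sigma>_def)
  have s2: "bij_betw \<sigma> {t..<k} S"
    using \<sigma>2 by (rule bij_betw_cong[THEN iffD1, rotated]) (simp add: \<sigma>_def)
  have un: "{..<t} \<union> {t..<k} = {..<k}" "(W - S) \<union> S = W"
    using t_le SW by auto
  have \<sigma>: "bij_betw \<sigma> {..<k} W"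
    using bij_betw_combine[OF s1 s2] unfolding un by blast
  have \<sigma>W: "\<sigma> l \<in> W" if "l < k" for l
    using \<sigma> that by (auto dest: bij_betwE)
  have \<sigma>_inj: "\<sigma> i = \<sigma> j \<longleftrightarrow> i = j" if "i < k" "j < k" for i j
    using bij_betw_imp_inj_on[OF \<sigma>] that by (auto dest: inj_onD)
  have \<sigma>S: "\<sigma> l \<in> S \<longleftrightarrow> l \<in> {t..<k}" if "l < k" for l
    using bij_betwE[OF s1] bij_betwE[OF s2] that by (cases "l < t") auto
  show ?thesis
  proof (rule model_in_frame[OF cb, of "\<lambda>l. v (\<sigma> l)" "\<lambda>l. n (\<sigma> l)"])
    fix q r assume "(\<Sum>l<k. q l *s v (\<sigma> l)) + (\<Sum>l<k. r l *s n (\<sigma> l)) = 0"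
    moreover have "(\<Sum>l<k. q l *s v (\<sigma> l)) = (\<Sum>z\<in>W. q (inv_into {..<k} \<sigma> z) *s v z)"
      "(\<Sum>l<k. r l *s n (\<sigma> l)) = (\<Sum>z\<in>W. r (inv_into {..<k} \<sigma> z) *s n z)"
      by (auto intro!: sum.reindex_bij_betw[OF \<sigma>, THEN trans[rotated]] sum.cong
          simp: bij_betw_inv_into_left[OF \<sigma>])
    ultimately have "(\<forall>z\<in>W. q (inv_into {..<k} \<sigma> z) = 0) \<and> (\<forall>z\<in>W. r (inv_into {..<k} \<sigma> z) = 0)"
      by (intro ind) simp
    then show "(\<forall>l<k. q l = 0) \<and> (\<forall>l<k. r l = 0)"
      using \<sigma>W bij_betw_inv_into_left[OF \<sigma>] by (metis lessThan_iff)
  qed (simp_all add: vn nv vv nn \<sigma>W \<sigma>_inj \<sigma>S)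
qed

lemma rigid_model: "rigid model"
  by (rule rigid_if_basic_open[OF model_Leib polyfun_D _ orbit_of_nonvanishing])
    (use D_cyc_model D_trace_model D_type_model in simp_all)

end

section \<open>Rigidity of the algebras \<open>L_t\<close>\<close>

text \<open>
  Labels are counted from \<open>1\<close> within each of the four families, positions from \<open>0\<close>.
\<close>

definition e_label :: "nat \<Rightarrow> nat \<Rightarrow> label" where
  "e_label t l = (if l < t then E (Suc l) else F (Suc (l - t)))"

definition h_label :: "nat \<Rightarrow> nat \<Rightarrow> label" where
  "h_label t l = (if l < t then X (Suc l) else Y (Suc (l - t)))"

lemma labels_eq:
  assumes "t \<le> k"
  shows "labels k t = e_label t ` {..<k} \<union> h_label t ` {..<k}"
proof (rule card_subset_eq[symmetric])
  show "finite (labels k t)" by (rule finite_labels)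
  show "e_label t ` {..<k} \<union> h_label t ` {..<k} \<subseteq> labels k t"
    using assms by (auto simp: labels_def e_label_def h_label_def)
  have "card (e_label t ` {..<k} \<union> h_label t ` {..<k})
      = card (e_label t ` {..<k}) + card (h_label t ` {..<k})"
    by (intro card_Un_disjoint) (auto simp: e_label_def h_label_def split: if_splits)
  also have "\<dots> = 2 * k"
    by (subst (1 2) card_image) (auto simp: inj_on_def e_label_def h_label_def split: if_splits)
  finally show "card (e_label t ` {..<k} \<union> h_label t ` {..<k}) = card (labels k t)"
    using card_labels[OF assms] by simp
qed

lemma basis_product_labels:
  "basis_product b (e_label t l) (h_label t l') = (if l = l' then basis_vec b (e_label t l) else 0)"
  "basis_product b (h_label t l) (e_label t l')
    = (if l = l' \<and> t \<le> l then - basis_vec b (e_label t l) else 0)"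
  "basis_product b (e_label t l) (e_label t l') = 0"
  "basis_product b (h_label t l) (h_label t l') = 0"
  by (auto simp: e_label_def h_label_def)

theorem theorem3p8:
  fixes k t :: nat and b :: "label \<Rightarrow> 'n::finite"
  assumes "k \<ge> 1" and "t \<le> k"
    and "CARD('n) = 2 * k"
    and "bij_betw b (labels k t) (UNIV :: 'n set)"
  shows "rigid (L_alg k t b)"
proof -
  note labels = labels_eq[OF assms(2)]
  have b_inj: "b p = b q \<longleftrightarrow> p = q" if "p \<in> labels k t" "q \<in> labels k t" for p q
    using assms(4) that by (auto simp: bij_betw_def inj_on_def)
  have e_inj: "inj_on (e_label t) {..<k}" and h_inj: "inj_on (h_label t) {..<k}"
    and e_h: "e_label t l \<noteq> h_label t l'" for l l'
    by (auto simp: inj_on_def e_label_def h_label_def split: if_splits)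
  interpret split_model "\<lambda>l. b (e_label t l)" "\<lambda>l. b (h_label t l)" k t
  proof
    show "inj_on (\<lambda>l. b (e_label t l)) {..<k}" "inj_on (\<lambda>l. b (h_label t l)) {..<k}"
      using e_inj h_inj by (auto simp: inj_on_def b_inj labels)
    show "b (e_label t l) \<noteq> b (h_label t l')" if "l < k" "l' < k" for l l'
      using that e_h by (simp add: b_inj labels)
    show "UNIV = (\<lambda>l. b (e_label t l)) ` {..<k} \<union> (\<lambda>l. b (h_label t l)) ` {..<k}"
      using assms(4) unfolding bij_betw_def labels by (auto simp: image_Un image_image)
  qed (rule assms(2))
  have sum_labels: "(\<Sum>p\<in>labels k t. f p) = (\<Sum>l<k. f (e_label t l)) + (\<Sum>l<k. f (h_label t l))"
    for f :: "label \<Rightarrow> complex^'n"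
    unfolding labels using e_h
    by (subst sum.union_disjoint) (auto simp: sum.reindex e_inj h_inj)
  have "L_alg k t b x y = model x y" for x y
  proof -
    have scale_if: "c *s (if P then v else 0) = (if P then c *s v else 0)"
      for c P and v :: "complex^'n" by simp
    have "L_alg k t b x y
        = (\<Sum>l<k. \<Sum>l'<k. if l = l' then (x $ b (e_label t l) * y $ b (h_label t l')) *s ee l else 0)
        + (\<Sum>l<k. \<Sum>l'<k. if l = l' then
            (if t \<le> l then - ((x $ b (h_label t l) * y $ b (e_label t l')) *s ee l) else 0) else 0)"
      unfolding L_alg_def sum_labels basis_product_labels
      by (auto simp: scale_if ee_def basis_vec_def intro!: arg_cong2[of _ _ _ _ plus] sum.cong)
    also have "\<dots> = model x y"
      unfolding model_def
      by (simp add: sum.distrib[symmetric])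
        (intro sum.cong, auto simp: vec.scale_left_diff_distrib)
    finally show ?thesis .
  qed
  then have "L_alg k t b = model" by (intro ext)
  then show ?thesis using rigid_model by simp
qed

end
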